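(* Let $k$ be a commutative ring, $G$ a group and $\mathcal{B}$ a $G$-graded category over $k$. Then the smash product category $\mathcal{B}\# G$, with the translation action of $G$, is a free $G$-category over $k$, and the quotient category $(\mathcal{B}\# G)/G$ is (canonically) isomorphic to $\mathcal{B}$.
   Context: Category over $k$: a small category with object set $\mathcal{B}_0$ such that each morphism set ${}_y\mathcal{B}_x$ (morphisms from $x$ to $y$) is a $k$-module and composition is $k$-bilinear. Isomorphisms of categories over $k$ are understood to be $k$-linear. $G$-graded category over $k$: a category $\mathcal{B}$ over $k$ with decompositions ${}_y\mathcal{B}_x=\bigoplus_{s\in G}{}_y\mathcal{B}_x^{\,s}$ such that ${}_z\mathcal{B}_y^{\,t}\;{}_y\mathcal{B}_x^{\,s}\subset{}_z\mathcal{B}_x^{\,ts}$ and ${}_x1_x\in{}_x\mathcal{B}_x^{\,1}$. Smash product category $\mathcal{B}\# G$: objects $\mathcal{B}_0\times G$, morphisms ${}_{(y,t)}(\mathcal{B}\# G)_{(x,s)}={}_y\mathcal{B}_x^{\,t^{-1}s}$, composition given by the composition ${}_z\mathcal{B}_y^{\,u^{-1}t}\otimes_k{}_y\mathcal{B}_x^{\,t^{-1}s}\to{}_z\mathcal{B}_x^{\,u^{-1}s}$ of $\mathcal{B}$. The translation action of $G$ is given on objects by $u(x,s)=(x,us)$, and on a morphism $f\in{}_{(y,t)}(\mathcal{B}\# G)_{(x,s)}={}_y\mathcal{B}_x^{\,t^{-1}s}$ by $uf=f\in{}_{(y,ut)}(\mathcal{B}\# G)_{(x,us)}={}_y\mathcal{B}_x^{\,t^{-1}s}$.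 $G$-category over $k$: a category $\mathcal{C}$ over $k$ with an action of $G$ on the set $\mathcal{C}_0$ and $k$-module maps $s:{}_y\mathcal{C}_x\to{}_{sy}\mathcal{C}_{sx}$ such that $s(gf)=(sg)(sf)$ for composable $g,f$, $(ts)f=t(sf)$ and $1f=f$. It is free if the action on $\mathcal{C}_0$ is free. Quotient category $\mathcal{C}/G$ (for $\mathcal{C}$ a free $G$-category): objects are the $G$-orbits of $\mathcal{C}_0$, and ${}_\beta(\mathcal{C}/G)_\alpha=\left(\bigoplus_{x\in\alpha,\,y\in\beta}{}_y\mathcal{C}_x\right)/G$, where for a $kG$-module $X$ one sets $X/G=X/(\ker\epsilon)X$ with $\epsilon:kG\to k$ the augmentation map. Composition: if $f\in{}_y\mathcal{C}_x$, $g\in{}_z\mathcal{C}_{y'}$ with $y,y'$ in the same orbit and $s$ is the unique element of $G$ with $sy=y'$, then $[g][f]=[g\circ(sf)]$. *)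

theory Defs
  imports "HOL-Algebra.Module" "HOL-Algebra.AbelCoset" "HOL-Algebra.Group_Action"
    "HOL-Algebra.Product_Groups" "HOL-Algebra.QuotRing"
begin

text \<open>
  Morphism sets carry the target first: \<open>Hom C y x\<close> is the module of morphisms from \<open>x\<close> to \<open>y\<close>,
  and \<open>Comp C z y x g f\<close> is the composite of \<open>f\<close> from \<open>x\<close> to \<open>y\<close> with \<open>g\<close> from \<open>y\<close> to \<open>z\<close>.
  The same convention is used for index pairs below.  The record type \<open>module\<close> extends \<open>ring\<close>;
  its fields \<open>mult\<close> and \<open>one\<close> play no role for modules and are left undefined where a module
  is constructed.
\<close>

record ('o, 'k, 'm) k_cat =
  Obj :: "'o set"
  Hom :: "'o \<Rightarrow> 'o \<Rightarrow> ('k, 'm) module"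
  Comp :: "'o \<Rightarrow> 'o \<Rightarrow> 'o \<Rightarrow> 'm \<Rightarrow> 'm \<Rightarrow> 'm"
  Idn :: "'o \<Rightarrow> 'm"

definition module_hom ::
  "('k, 'r) ring_scheme \<Rightarrow> ('k, 'm) module \<Rightarrow> ('k, 'n) module \<Rightarrow> ('m \<Rightarrow> 'n) set" where
  "module_hom R M N = {h \<in> carrier M \<rightarrow> carrier N.
     (\<forall>v\<in>carrier M. \<forall>w\<in>carrier M. h (v \<oplus>\<^bsub>M\<^esub> w) = h v \<oplus>\<^bsub>N\<^esub> h w) \<and>
     (\<forall>a\<in>carrier R. \<forall>v\<in>carrier M. h (a \<odot>\<^bsub>M\<^esub> v) = a \<odot>\<^bsub>N\<^esub> h v)}"

locale k_category = cring R for R :: "('k, 'r) ring_scheme" (structure) +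
  fixes C :: "('o, 'k, 'm) k_cat"
  assumes hom_module: "\<lbrakk>x \<in> Obj C; y \<in> Obj C\<rbrakk> \<Longrightarrow> module R (Hom C y x)"
    and comp_linear_left:
      "\<lbrakk>x \<in> Obj C; y \<in> Obj C; z \<in> Obj C; f \<in> carrier (Hom C y x)\<rbrakk>
        \<Longrightarrow> (\<lambda>g. Comp C z y x g f) \<in> module_hom R (Hom C z y) (Hom C z x)"
    and comp_linear_right:
      "\<lbrakk>x \<in> Obj C; y \<in> Obj C; z \<in> Obj C; g \<in> carrier (Hom C z y)\<rbrakk>
        \<Longrightarrow> (\<lambda>f. Comp C z y x g f) \<in> module_hom R (Hom C y x) (Hom C z x)"
    and comp_assoc:
      "\<lbrakk>w \<in> Obj C; x \<in> Obj C; y \<in> Obj C; z \<in> Obj C;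
        f \<in> carrier (Hom C x w); g \<in> carrier (Hom C y x); h \<in> carrier (Hom C z y)\<rbrakk>
        \<Longrightarrow> Comp C z x w (Comp C z y x h g) f = Comp C z y w h (Comp C y x w g f)"
    and id_closed: "x \<in> Obj C \<Longrightarrow> Idn C x \<in> carrier (Hom C x x)"
    and id_left:
      "\<lbrakk>x \<in> Obj C; y \<in> Obj C; f \<in> carrier (Hom C y x)\<rbrakk> \<Longrightarrow> Comp C y y x (Idn C y) f = f"
    and id_right:
      "\<lbrakk>x \<in> Obj C; y \<in> Obj C; f \<in> carrier (Hom C y x)\<rbrakk> \<Longrightarrow> Comp C y x x f (Idn C x) = f"

locale k_functor = A: k_category R A + B: k_category R B
  for R :: "('k, 'r) ring_scheme" (structure)
    and A :: "('a, 'k, 'm) k_cat" and B :: "('b, 'k, 'n) k_cat" +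
  fixes Fo :: "'a \<Rightarrow> 'b" and Fm :: "'a \<Rightarrow> 'a \<Rightarrow> 'm \<Rightarrow> 'n"
  assumes obj_closed: "Fo \<in> Obj A \<rightarrow> Obj B"
    and hom_linear:
      "\<lbrakk>x \<in> Obj A; y \<in> Obj A\<rbrakk> \<Longrightarrow> Fm y x \<in> module_hom R (Hom A y x) (Hom B (Fo y) (Fo x))"
    and preserves_comp:
      "\<lbrakk>x \<in> Obj A; y \<in> Obj A; z \<in> Obj A; f \<in> carrier (Hom A y x); g \<in> carrier (Hom A z y)\<rbrakk>
        \<Longrightarrow> Fm z x (Comp A z y x g f) = Comp B (Fo z) (Fo y) (Fo x) (Fm z y g) (Fm y x f)"
    and preserves_id: "x \<in> Obj A \<Longrightarrow> Fm x x (Idn A x) = Idn B (Fo x)"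

locale k_category_iso = k_functor +
  assumes inverse_functor:
    "\<exists>Go Gm. k_functor R B A Go Gm \<and>
      (\<forall>x\<in>Obj A. Go (Fo x) = x) \<and>
      (\<forall>x\<in>Obj B. Fo (Go x) = x) \<and>
      (\<forall>x\<in>Obj A. \<forall>y\<in>Obj A. \<forall>f\<in>carrier (Hom A y x). Gm (Fo y) (Fo x) (Fm y x f) = f) \<and>
      (\<forall>x\<in>Obj B. \<forall>y\<in>Obj B. \<forall>f\<in>carrier (Hom B y x). Fm (Go y) (Go x) (Gm y x f) = f)"


section \<open>Graded categories and smash products\<close>

definition internal_direct_sum :: "('k, 'm) module \<Rightarrow> 'i set \<Rightarrow> ('i \<Rightarrow> 'm set) \<Rightarrow> bool" where
  "internal_direct_sum M I D \<longleftrightarrow>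
     (\<forall>v\<in>carrier M. \<exists>!c. c \<in> (\<Pi>\<^sub>E i\<in>I. D i) \<and> finite {i \<in> I. c i \<noteq> \<zero>\<^bsub>M\<^esub>} \<and>
        v = (\<Oplus>\<^bsub>M\<^esub>i\<in>{i \<in> I. c i \<noteq> \<zero>\<^bsub>M\<^esub>}. c i))"

text \<open>\<open>D y x s\<close> is the component of degree \<open>s\<close> of \<open>Hom B y x\<close>.\<close>

locale graded_category = k_category R B + G: group G
  for R :: "('k, 'r) ring_scheme" (structure) and G :: "('g, 'h) monoid_scheme"
    and B :: "('o, 'k, 'm) k_cat" +
  fixes D :: "'o \<Rightarrow> 'o \<Rightarrow> 'g \<Rightarrow> 'm set"
  assumes degree_submodule:
      "\<lbrakk>x \<in> Obj B; y \<in> Obj B; s \<in> carrier G\<rbrakk> \<Longrightarrow> submodule (D y x s) R (Hom B y x)"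
    and degree_direct_sum:
      "\<lbrakk>x \<in> Obj B; y \<in> Obj B\<rbrakk> \<Longrightarrow> internal_direct_sum (Hom B y x) (carrier G) (D y x)"
    and degree_comp:
      "\<lbrakk>x \<in> Obj B; y \<in> Obj B; z \<in> Obj B; s \<in> carrier G; t \<in> carrier G;
        f \<in> D y x s; g \<in> D z y t\<rbrakk> \<Longrightarrow> Comp B z y x g f \<in> D z x (t \<otimes>\<^bsub>G\<^esub> s)"
    and degree_id: "x \<in> Obj B \<Longrightarrow> Idn B x \<in> D x x \<one>\<^bsub>G\<^esub>"

definition smash_product ::
  "('g, 'h) monoid_scheme \<Rightarrow> ('o, 'k, 'm) k_cat \<Rightarrow> ('o \<Rightarrow> 'o \<Rightarrow> 'g \<Rightarrow> 'm set)
    \<Rightarrow> ('o \<times> 'g, 'k, 'm) k_cat" where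
  "smash_product G B D =
     \<lparr>Obj = Obj B \<times> carrier G,
      Hom = (\<lambda>(y, t) (x, s). (Hom B y x)\<lparr>carrier := D y x (inv\<^bsub>G\<^esub> t \<otimes>\<^bsub>G\<^esub> s)\<rparr>),
      Comp = (\<lambda>(z, u) (y, t) (x, s). Comp B z y x),
      Idn = (\<lambda>(x, s). Idn B x)\<rparr>"

definition translation_obj ::
  "('g, 'h) monoid_scheme \<Rightarrow> ('o, 'k, 'm) k_cat \<Rightarrow> 'g \<Rightarrow> 'o \<times> 'g \<Rightarrow> 'o \<times> 'g" where
  "translation_obj G B u = (\<lambda>(x, s)\<in>Obj B \<times> carrier G. (x, u \<otimes>\<^bsub>G\<^esub> s))"

definition translation_mor :: "'g \<Rightarrow> 'o \<times> 'g \<Rightarrow> 'o \<times> 'g \<Rightarrow> 'm \<Rightarrow> 'm" where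
  "translation_mor u y x f = f"


section \<open>\<open>G\<close>-categories\<close>

text \<open>\<open>\<phi> s\<close> is the action of \<open>s\<close> on objects, \<open>\<psi> s y x\<close> its action on \<open>Hom C y x\<close>.\<close>

locale G_category = k_category R C + G: group G + group_action G "Obj C" \<phi>
  for R :: "('k, 'r) ring_scheme" (structure) and G :: "('g, 'h) monoid_scheme"
    and C :: "('o, 'k, 'm) k_cat" and \<phi> :: "'g \<Rightarrow> 'o \<Rightarrow> 'o" +
  fixes \<psi> :: "'g \<Rightarrow> 'o \<Rightarrow> 'o \<Rightarrow> 'm \<Rightarrow> 'm"
  assumes act_linear:
      "\<lbrakk>s \<in> carrier G; x \<in> Obj C; y \<in> Obj C\<rbrakk>
        \<Longrightarrow> \<psi> s y x \<in> module_hom R (Hom C y x) (Hom C (\<phi> s y) (\<phi> s x))"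
    and act_comp:
      "\<lbrakk>s \<in> carrier G; x \<in> Obj C; y \<in> Obj C; z \<in> Obj C;
        f \<in> carrier (Hom C y x); g \<in> carrier (Hom C z y)\<rbrakk>
        \<Longrightarrow> \<psi> s z x (Comp C z y x g f) = Comp C (\<phi> s z) (\<phi> s y) (\<phi> s x) (\<psi> s z y g) (\<psi> s y x f)"
    and act_mult:
      "\<lbrakk>s \<in> carrier G; t \<in> carrier G; x \<in> Obj C; y \<in> Obj C; f \<in> carrier (Hom C y x)\<rbrakk>
        \<Longrightarrow> \<psi> (t \<otimes>\<^bsub>G\<^esub> s) y x f = \<psi> t (\<phi> s y) (\<phi> s x) (\<psi> s y x f)"
    and act_one:
      "\<lbrakk>x \<in> Obj C; y \<in> Obj C; f \<in> carrier (Hom C y x)\<rbrakk> \<Longrightarrow> \<psi> \<one>\<^bsub>G\<^esub> y x f = f"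

locale free_G_category = G_category +
  assumes free: "x \<in> Obj C \<Longrightarrow> stabilizer G \<phi> x = {\<one>\<^bsub>G\<^esub>}"


section \<open>The quotient \<open>X/G = X/(ker \<epsilon>)X\<close> of a module with \<open>G\<close>-action\<close>

definition group_algebra ::
  "('k, 'r) ring_scheme \<Rightarrow> ('g, 'h) monoid_scheme \<Rightarrow> ('g \<Rightarrow> 'k) ring" where
  "group_algebra R G =
     \<lparr>carrier = {a \<in> carrier G \<rightarrow>\<^sub>E carrier R. finite {g \<in> carrier G. a g \<noteq> \<zero>\<^bsub>R\<^esub>}},
      monoid.mult = (\<lambda>a b. \<lambda>g\<in>carrier G.
        \<Oplus>\<^bsub>R\<^esub>h\<in>{h \<in> carrier G. a h \<noteq> \<zero>\<^bsub>R\<^esub>}. a h \<otimes>\<^bsub>R\<^esub> b (inv\<^bsub>G\<^esub> h \<otimes>\<^bsub>G\<^esub> g)),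
      one = (\<lambda>g\<in>carrier G. if g = \<one>\<^bsub>G\<^esub> then \<one>\<^bsub>R\<^esub> else \<zero>\<^bsub>R\<^esub>),
      zero = (\<lambda>g\<in>carrier G. \<zero>\<^bsub>R\<^esub>),
      add = (\<lambda>a b. \<lambda>g\<in>carrier G. a g \<oplus>\<^bsub>R\<^esub> b g)\<rparr>"

definition augmentation ::
  "('k, 'r) ring_scheme \<Rightarrow> ('g, 'h) monoid_scheme \<Rightarrow> ('g \<Rightarrow> 'k) \<Rightarrow> 'k" where
  "augmentation R G a = (\<Oplus>\<^bsub>R\<^esub>g\<in>{g \<in> carrier G. a g \<noteq> \<zero>\<^bsub>R\<^esub>}. a g)"

text \<open>A \<open>kG\<close>-module is given by a \<open>k\<close>-module \<open>X\<close> and a \<open>k\<close>-linear action \<open>\<rho>\<close> of \<open>G\<close> on it;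
  this is the resulting scalar multiplication by elements of \<open>kG\<close>.\<close>

definition group_algebra_smult ::
  "('k, 'r) ring_scheme \<Rightarrow> ('g, 'h) monoid_scheme \<Rightarrow> ('k, 'x) module \<Rightarrow> ('g \<Rightarrow> 'x \<Rightarrow> 'x)
    \<Rightarrow> ('g \<Rightarrow> 'k) \<Rightarrow> 'x \<Rightarrow> 'x" where
  "group_algebra_smult R G X \<rho> a v =
     (\<Oplus>\<^bsub>X\<^esub>g\<in>{g \<in> carrier G. a g \<noteq> \<zero>\<^bsub>R\<^esub>}. a g \<odot>\<^bsub>X\<^esub> \<rho> g v)"

definition augmentation_submodule ::
  "('k, 'r) ring_scheme \<Rightarrow> ('g, 'h) monoid_scheme \<Rightarrow> ('k, 'x) module \<Rightarrow> ('g \<Rightarrow> 'x \<Rightarrow> 'x)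
    \<Rightarrow> 'x set" where
  "augmentation_submodule R G X \<rho> =
     generate (add_monoid X)
       {group_algebra_smult R G X \<rho> a v | a v.
          a \<in> a_kernel (group_algebra R G) R (augmentation R G) \<and> v \<in> carrier X}"

definition quotient_module :: "('k, 'x) module \<Rightarrow> 'x set \<Rightarrow> ('k, 'x set) module" where
  "quotient_module X N =
     \<lparr>carrier = a_rcosets\<^bsub>X\<^esub> N, monoid.mult = undefined, one = undefined,
      zero = N, add = set_add X, smult = (\<lambda>a P. \<Union>v\<in>P. N +>\<^bsub>X\<^esub> (a \<odot>\<^bsub>X\<^esub> v))\<rparr>"


section \<open>Quotient categories\<close>

definition direct_sum_module :: "'i set \<Rightarrow> ('i \<Rightarrow> ('k, 'm) module) \<Rightarrow> ('k, 'i \<Rightarrow> 'm) module" where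
  "direct_sum_module I M =
     \<lparr>carrier = carrier (sum_group I (\<lambda>i. add_monoid (M i))),
      monoid.mult = undefined, one = undefined,
      zero = \<one>\<^bsub>sum_group I (\<lambda>i. add_monoid (M i))\<^esub>,
      add = monoid.mult (sum_group I (\<lambda>i. add_monoid (M i))),
      smult = (\<lambda>a v. \<lambda>i\<in>I. a \<odot>\<^bsub>M i\<^esub> v i)\<rparr>"

definition direct_sum_incl :: "'i set \<Rightarrow> ('i \<Rightarrow> ('k, 'm) module) \<Rightarrow> 'i \<Rightarrow> 'm \<Rightarrow> 'i \<Rightarrow> 'm" where
  "direct_sum_incl I M i f = (\<lambda>j\<in>I. if j = i then f else \<zero>\<^bsub>M j\<^esub>)"

definition orbit_homs ::
  "('o, 'k, 'm) k_cat \<Rightarrow> 'o set \<Rightarrow> 'o set \<Rightarrow> ('k, 'o \<times> 'o \<Rightarrow> 'm) module" where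
  "orbit_homs C \<beta> \<alpha> = direct_sum_module (\<beta> \<times> \<alpha>) (\<lambda>(y, x). Hom C y x)"

definition orbit_homs_incl ::
  "('o, 'k, 'm) k_cat \<Rightarrow> 'o set \<Rightarrow> 'o set \<Rightarrow> 'o \<Rightarrow> 'o \<Rightarrow> 'm \<Rightarrow> 'o \<times> 'o \<Rightarrow> 'm" where
  "orbit_homs_incl C \<beta> \<alpha> y x f = direct_sum_incl (\<beta> \<times> \<alpha>) (\<lambda>(y, x). Hom C y x) (y, x) f"

text \<open>The action of \<open>s\<close> maps the summand at \<open>(y, x)\<close> to the one at \<open>(s y, s x)\<close>, so the entry of
  \<open>s v\<close> at \<open>(y, x)\<close> comes from the entry of \<open>v\<close> at the translate of \<open>(y, x)\<close> by the inverse of \<open>s\<close>.\<close>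

definition orbit_homs_action ::
  "('g, 'h) monoid_scheme \<Rightarrow> ('g \<Rightarrow> 'o \<Rightarrow> 'o) \<Rightarrow> ('g \<Rightarrow> 'o \<Rightarrow> 'o \<Rightarrow> 'm \<Rightarrow> 'm)
    \<Rightarrow> 'o set \<Rightarrow> 'o set \<Rightarrow> 'g \<Rightarrow> ('o \<times> 'o \<Rightarrow> 'm) \<Rightarrow> 'o \<times> 'o \<Rightarrow> 'm" where
  "orbit_homs_action G \<phi> \<psi> \<beta> \<alpha> s v =
     (\<lambda>(y, x)\<in>\<beta> \<times> \<alpha>. let y' = \<phi> (inv\<^bsub>G\<^esub> s) y; x' = \<phi> (inv\<^bsub>G\<^esub> s) x in \<psi> s y' x' (v (y', x')))"

definition orbit_homs_kernel ::
  "('k, 'r) ring_scheme \<Rightarrow> ('g, 'h) monoid_scheme \<Rightarrow> ('o, 'k, 'm) k_cat \<Rightarrow> ('g \<Rightarrow> 'o \<Rightarrow> 'o)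
    \<Rightarrow> ('g \<Rightarrow> 'o \<Rightarrow> 'o \<Rightarrow> 'm \<Rightarrow> 'm) \<Rightarrow> 'o set \<Rightarrow> 'o set \<Rightarrow> ('o \<times> 'o \<Rightarrow> 'm) set" where
  "orbit_homs_kernel R G C \<phi> \<psi> \<beta> \<alpha> =
     augmentation_submodule R G (orbit_homs C \<beta> \<alpha>) (orbit_homs_action G \<phi> \<psi> \<beta> \<alpha>)"

text \<open>The class \<open>[f]\<close> of a morphism \<open>f\<close> from \<open>x\<close> to \<open>y\<close>, in the quotient of \<open>orbit_homs C \<beta> \<alpha>\<close>
  where \<open>x \<in> \<alpha>\<close> and \<open>y \<in> \<beta>\<close>.\<close>

definition quotient_class ::
  "('k, 'r) ring_scheme \<Rightarrow> ('g, 'h) monoid_scheme \<Rightarrow> ('o, 'k, 'm) k_cat \<Rightarrow> ('g \<Rightarrow> 'o \<Rightarrow> 'o)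
    \<Rightarrow> ('g \<Rightarrow> 'o \<Rightarrow> 'o \<Rightarrow> 'm \<Rightarrow> 'm) \<Rightarrow> 'o set \<Rightarrow> 'o set \<Rightarrow> 'o \<Rightarrow> 'o \<Rightarrow> 'm \<Rightarrow> ('o \<times> 'o \<Rightarrow> 'm) set" where
  "quotient_class R G C \<phi> \<psi> \<beta> \<alpha> y x f =
     orbit_homs_kernel R G C \<phi> \<psi> \<beta> \<alpha> +>\<^bsub>orbit_homs C \<beta> \<alpha>\<^esub> orbit_homs_incl C \<beta> \<alpha> y x f"

text \<open>The biadditive extension of \<open>(g, f) \<mapsto> g \<circ> (s f)\<close>, for \<open>f\<close> from \<open>x\<close> to \<open>y\<close>, \<open>g\<close> from \<open>y'\<close> to
  \<open>z\<close> and \<open>s\<close> the unique element of \<open>G\<close> with \<open>s y = y'\<close>, to finitely supported families.\<close>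

definition orbit_homs_comp ::
  "('g, 'h) monoid_scheme \<Rightarrow> ('o, 'k, 'm) k_cat \<Rightarrow> ('g \<Rightarrow> 'o \<Rightarrow> 'o)
    \<Rightarrow> ('g \<Rightarrow> 'o \<Rightarrow> 'o \<Rightarrow> 'm \<Rightarrow> 'm) \<Rightarrow> 'o set \<Rightarrow> 'o set \<Rightarrow> 'o set
    \<Rightarrow> ('o \<times> 'o \<Rightarrow> 'm) \<Rightarrow> ('o \<times> 'o \<Rightarrow> 'm) \<Rightarrow> 'o \<times> 'o \<Rightarrow> 'm" where
  "orbit_homs_comp G C \<phi> \<psi> \<gamma> \<beta> \<alpha> g f =
     finsum (orbit_homs C \<gamma> \<alpha>)
       (\<lambda>((z, y'), (y, x)).
          let s = (THE s. s \<in> carrier G \<and> \<phi> s y = y')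
          in orbit_homs_incl C \<gamma> \<alpha> z (\<phi> s x)
               (Comp C z y' (\<phi> s x) (g (z, y')) (\<psi> s y x (f (y, x)))))
       {((z, y'), (y, x)). z \<in> \<gamma> \<and> y' \<in> \<beta> \<and> y \<in> \<beta> \<and> x \<in> \<alpha> \<and>
          g (z, y') \<noteq> \<zero>\<^bsub>Hom C z y'\<^esub> \<and> f (y, x) \<noteq> \<zero>\<^bsub>Hom C y x\<^esub>}"

text \<open>As for \<^const>\<open>rcoset_mult\<close>, operations on cosets are unions over all representatives: if the
  operation is well defined, all members of the union are the same coset.\<close>

definition quotient_category ::
  "('k, 'r) ring_scheme \<Rightarrow> ('g, 'h) monoid_scheme \<Rightarrow> ('o, 'k, 'm) k_cat \<Rightarrow> ('g \<Rightarrow> 'o \<Rightarrow> 'o)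
    \<Rightarrow> ('g \<Rightarrow> 'o \<Rightarrow> 'o \<Rightarrow> 'm \<Rightarrow> 'm) \<Rightarrow> ('o set, 'k, ('o \<times> 'o \<Rightarrow> 'm) set) k_cat" where
  "quotient_category R G C \<phi> \<psi> =
     \<lparr>Obj = orbits G (Obj C) \<phi>,
      Hom = (\<lambda>\<beta> \<alpha>. quotient_module (orbit_homs C \<beta> \<alpha>) (orbit_homs_kernel R G C \<phi> \<psi> \<beta> \<alpha>)),
      Comp = (\<lambda>\<gamma> \<beta> \<alpha> Q P. \<Union>g\<in>Q. \<Union>f\<in>P.
        orbit_homs_kernel R G C \<phi> \<psi> \<gamma> \<alpha>
          +>\<^bsub>orbit_homs C \<gamma> \<alpha>\<^esub> orbit_homs_comp G C \<phi> \<psi> \<gamma> \<beta> \<alpha> g f),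
      Idn = (\<lambda>\<alpha>. \<Union>x\<in>\<alpha>. quotient_class R G C \<phi> \<psi> \<alpha> \<alpha> x x (Idn C x))\<rparr>"

end

theory Submission
  imports Defs
begin

text \<open>
  For \<open>x, y\<close> in \<open>B\<close> the orbits of \<open>(x, s)\<close> and \<open>(y, t)\<close> are \<open>{x} \<times> G\<close> and \<open>{y} \<times> G\<close>, and adding up
  the entries of a finitely supported family of homogeneous morphisms defines a map from the sum
  \<open>X = \<Oplus>\<^bsub>t,s\<^esub> D y x (t\<inverse>s)\<close> to \<open>Hom B y x\<close>.  It is \<open>G\<close>-invariant and onto.  Its kernel is \<open>(ker \<epsilon>)X\<close>:
  modulo \<open>(ker \<epsilon>)X\<close> every entry can be translated to one with target \<open>(y, 1)\<close>, and on families
  supported there the sum determines the entries, the grading being direct.  Hence the morphisms of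
  the quotient category are exactly the fibres of the sum map, indexed by the morphisms of \<open>B\<close>, and
  the sum map turns composition in the quotient into composition in \<open>B\<close>.
\<close>

section \<open>Transport of structure\<close>

text \<open>Every element of \<open>N\<close> is some \<open>h v\<close>, so each module law of
  \<open>N\<close> is the image of the same law of \<open>M\<close>. Nothing is known about
  \<open>N\<close> beforehand, hence its zero has to be matched explicitly. This makes the quotient
  morphism sets modules without calculating with cosets.\<close>

lemma module_transport:
  assumes M: "module R M" and bij: "bij_betw h (carrier M) (carrier N)"
    and zero: "h \<zero>\<^bsub>M\<^esub> = \<zero>\<^bsub>N\<^esub>"
    and add: "\<And>v w. \<lbrakk>v \<in> carrier M; w \<in> carrier M\<rbrakk> \<Longrightarrow> h (v \<oplus>\<^bsub>M\<^esub> w) = h v \<oplus>\<^bsub>N\<^esub> h w"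
    and smult: "\<And>a v. \<lbrakk>a \<in> carrier R; v \<in> carrier M\<rbrakk> \<Longrightarrow> h (a \<odot>\<^bsub>M\<^esub> v) = a \<odot>\<^bsub>N\<^esub> h v"
  shows "module R N"
proof -
  interpret M: module R M by fact
  have N: "carrier N = h ` carrier M" using bij by (simp add: bij_betw_def)
  show ?thesis
  proof (rule moduleI)
    show "cring R" by (rule M.is_cring)
    show "abelian_group N"
    proof (rule abelian_groupI)
      fix x assume "x \<in> carrier N"
      then obtain v where v: "v \<in> carrier M" "x = h v" using N by auto
      then have "h (\<ominus>\<^bsub>M\<^esub> v) \<oplus>\<^bsub>N\<^esub> x = \<zero>\<^bsub>N\<^esub>"
        by (metis M.M.a_inv_closed M.l_neg add zero)
      then show "\<exists>y\<in>carrier N. y \<oplus>\<^bsub>N\<^esub> x = \<zero>\<^bsub>N\<^esub>"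
        using v N by (metis M.M.a_inv_closed imageI)
    next
      show "\<zero>\<^bsub>N\<^esub> \<in> carrier N" using N zero by (metis M.M.zero_closed imageI)
    next
      fix x y assume "x \<in> carrier N" "y \<in> carrier N"
      then show "x \<oplus>\<^bsub>N\<^esub> y = y \<oplus>\<^bsub>N\<^esub> x"
        by (auto simp: N add[symmetric] M.a_comm)
    qed (auto simp: N add[symmetric] zero[symmetric] M.a_assoc)
  qed (auto simp: N add[symmetric] smult[symmetric] M.smult_l_distr M.smult_r_distr M.smult_assoc1)
qed

lemma module_homD:
  assumes "h \<in> module_hom R M N"
  shows "v \<in> carrier M \<Longrightarrow> h v \<in> carrier N"
    and "\<lbrakk>v \<in> carrier M; w \<in> carrier M\<rbrakk> \<Longrightarrow> h (v \<oplus>\<^bsub>M\<^esub> w) = h v \<oplus>\<^bsub>N\<^esub> h w"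
    and "\<lbrakk>a \<in> carrier R; v \<in> carrier M\<rbrakk> \<Longrightarrow> h (a \<odot>\<^bsub>M\<^esub> v) = a \<odot>\<^bsub>N\<^esub> h v"
  using assms by (auto simp: module_hom_def)

lemma module_homI:
  assumes "\<And>v. v \<in> carrier M \<Longrightarrow> h v \<in> carrier N"
    and "\<And>v w. \<lbrakk>v \<in> carrier M; w \<in> carrier M\<rbrakk> \<Longrightarrow> h (v \<oplus>\<^bsub>M\<^esub> w) = h v \<oplus>\<^bsub>N\<^esub> h w"
    and "\<And>a v. \<lbrakk>a \<in> carrier R; v \<in> carrier M\<rbrakk> \<Longrightarrow> h (a \<odot>\<^bsub>M\<^esub> v) = a \<odot>\<^bsub>N\<^esub> h v"
  shows "h \<in> module_hom R M N"
  using assms by (auto simp: module_hom_def)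

lemma module_hom_zero:
  assumes "module R M" "module R N" "h \<in> module_hom R M N"
  shows "h \<zero>\<^bsub>M\<^esub> = \<zero>\<^bsub>N\<^esub>"
proof -
  interpret M: module R M by fact
  interpret N: module R N by fact
  show ?thesis
    using module_homD(3)[OF assms(3), of "\<zero>\<^bsub>R\<^esub>" "\<zero>\<^bsub>M\<^esub>"] module_homD(1)[OF assms(3), of "\<zero>\<^bsub>M\<^esub>"]
    by simp
qed

lemma module_hom_finsum:
  assumes "module R M" "module R N" "h \<in> module_hom R M N" "f \<in> A \<rightarrow> carrier M"
  shows "h (\<Oplus>\<^bsub>M\<^esub>i\<in>A. f i) = (\<Oplus>\<^bsub>N\<^esub>i\<in>A. h (f i))"
proof -
  interpret M: module R M by fact
  interpret N: module R N by fact
  show ?thesis using assms(4)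
  \<comment> \<open>Over an infinite index set both sums are zero by convention.\<close>
  proof (induction A rule: infinite_finite_induct)
    case (insert a A)
    then show ?case by (auto simp: module_homD[OF assms(3)] Pi_def)
  qed (auto simp: module_hom_zero[OF assms(1-3)])
qed

section \<open>Categories over \<open>R\<close>\<close>

text \<open>All objects and morphisms of \<open>Q\<close> are images under \<open>Go\<close> and
  \<open>Gm\<close>, so the laws of \<open>B\<close> pass to \<open>Q\<close>, which is not assumed
  to be a category. The data run from \<open>B\<close> to \<open>Q\<close>, the direction that is
  easy to write down for a quotient; the isomorphism produced is their inverse.\<close>

lemma k_category_iso_transport:
  fixes Q :: "('q, 'k, 'n) k_cat" and B :: "('o, 'k, 'm) k_cat"
    and Go :: "'o \<Rightarrow> 'q" and Gm :: "'o \<Rightarrow> 'o \<Rightarrow> 'm \<Rightarrow> 'n"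
  assumes B: "k_category R B"
    and obj: "bij_betw Go (Obj B) (Obj Q)"
    and hom: "\<And>x y. \<lbrakk>x \<in> Obj B; y \<in> Obj B\<rbrakk> \<Longrightarrow>
      bij_betw (Gm y x) (carrier (Hom B y x)) (carrier (Hom Q (Go y) (Go x)))"
    and zero: "\<And>x y. \<lbrakk>x \<in> Obj B; y \<in> Obj B\<rbrakk> \<Longrightarrow> Gm y x \<zero>\<^bsub>Hom B y x\<^esub> = \<zero>\<^bsub>Hom Q (Go y) (Go x)\<^esub>"
    and lin: "\<And>x y. \<lbrakk>x \<in> Obj B; y \<in> Obj B\<rbrakk> \<Longrightarrow>
      Gm y x \<in> module_hom R (Hom B y x) (Hom Q (Go y) (Go x))"
    and comp: "\<And>x y z f g. \<lbrakk>x \<in> Obj B; y \<in> Obj B; z \<in> Obj B;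
        f \<in> carrier (Hom B y x); g \<in> carrier (Hom B z y)\<rbrakk> \<Longrightarrow>
      Gm z x (Comp B z y x g f) = Comp Q (Go z) (Go y) (Go x) (Gm z y g) (Gm y x f)"
    and idn: "\<And>x. x \<in> Obj B \<Longrightarrow> Gm x x (Idn B x) = Idn Q (Go x)"
  shows "\<exists>Fo Fm. k_category_iso R Q B Fo Fm \<and> (\<forall>x\<in>Obj B. Fo (Go x) = x) \<and>
    (\<forall>x\<in>Obj B. \<forall>y\<in>Obj B. \<forall>f\<in>carrier (Hom B y x). Fm (Go y) (Go x) (Gm y x f) = f)"
proof -
  interpret B: k_category R B by fact
  have Q: "Obj Q = Go ` Obj B" using obj by (simp add: bij_betw_def)
  have homQ: "carrier (Hom Q (Go y) (Go x)) = Gm y x ` carrier (Hom B y x)"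
    if "x \<in> Obj B" "y \<in> Obj B" for x y
    using hom[OF that] by (simp add: bij_betw_def)
  have Bcomp [simp]: "Comp B z y x g f \<in> carrier (Hom B z x)"
    if "x \<in> Obj B" "y \<in> Obj B" "z \<in> Obj B" "f \<in> carrier (Hom B y x)" "g \<in> carrier (Hom B z y)"
    for x y z f g
    using module_homD(1)[OF B.comp_linear_left[OF that(1-4)] that(5)] .
  have Bid [simp]: "x \<in> Obj B \<Longrightarrow> Idn B x \<in> carrier (Hom B x x)" for x by (rule B.id_closed)
  note Glin = module_homD(2,3)[OF lin, symmetric]
  have modQ: "module R (Hom Q (Go y) (Go x))" if "x \<in> Obj B" "y \<in> Obj B" for x y
    by (rule module_transport[OF B.hom_module hom zero]) (simp_all add: that module_homD(2,3)[OF lin])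
  have Bmod: "\<lbrakk>v \<in> carrier (Hom B y x); w \<in> carrier (Hom B y x)\<rbrakk> \<Longrightarrow>
      v \<oplus>\<^bsub>Hom B y x\<^esub> w \<in> carrier (Hom B y x)"
    "\<lbrakk>a \<in> carrier R; v \<in> carrier (Hom B y x)\<rbrakk> \<Longrightarrow> a \<odot>\<^bsub>Hom B y x\<^esub> v \<in> carrier (Hom B y x)"
    if "x \<in> Obj B" "y \<in> Obj B" for x y v w a
  proof -
    interpret M: module R "Hom B y x" using that by (rule B.hom_module)
    show "\<lbrakk>v \<in> carrier (Hom B y x); w \<in> carrier (Hom B y x)\<rbrakk> \<Longrightarrow>
        v \<oplus>\<^bsub>Hom B y x\<^esub> w \<in> carrier (Hom B y x)"
      "\<lbrakk>a \<in> carrier R; v \<in> carrier (Hom B y x)\<rbrakk> \<Longrightarrow> a \<odot>\<^bsub>Hom B y x\<^esub> v \<in> carrier (Hom B y x)"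
      by simp_all
  qed
  have catQ: "k_category R Q"
  proof (intro k_category.intro k_category_axioms.intro)
    fix x y assume "x \<in> Obj Q" "y \<in> Obj Q"
    then show "module R (Hom Q y x)" using modQ by (auto simp: Q)
  next
    fix x y z f assume "x \<in> Obj Q" "y \<in> Obj Q" "z \<in> Obj Q" "f \<in> carrier (Hom Q y x)"
    then obtain x' y' z' f' where *: "x' \<in> Obj B" "y' \<in> Obj B" "z' \<in> Obj B" "f' \<in> carrier (Hom B y' x')"
      "x = Go x'" "y = Go y'" "z = Go z'" "f = Gm y' x' f'"
      by (auto simp: Q homQ)
    show "(\<lambda>g. Comp Q z y x g f) \<in> module_hom R (Hom Q z y) (Hom Q z x)"
      using * by (auto intro!: module_homI simp: homQ comp[symmetric] Glin Bmod
        module_homD(2,3)[OF B.comp_linear_left])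
  next
    fix x y z g assume "x \<in> Obj Q" "y \<in> Obj Q" "z \<in> Obj Q" "g \<in> carrier (Hom Q z y)"
    then obtain x' y' z' g' where *: "x' \<in> Obj B" "y' \<in> Obj B" "z' \<in> Obj B" "g' \<in> carrier (Hom B z' y')"
      "x = Go x'" "y = Go y'" "z = Go z'" "g = Gm z' y' g'"
      by (auto simp: Q homQ)
    show "(\<lambda>f. Comp Q z y x g f) \<in> module_hom R (Hom Q y x) (Hom Q z x)"
      using * by (auto intro!: module_homI simp: homQ comp[symmetric] Glin Bmod
        module_homD(2,3)[OF B.comp_linear_right])
  qed (auto simp: B.is_cring Q homQ comp[symmetric] idn[symmetric] B.comp_assoc B.id_left B.id_right)
  define Fo where "Fo = inv_into (Obj B) Go"
  \<comment> \<open>\<open>Gm\<close> is indexed by objects of \<open>B\<close>, so its inverse at a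
    pair of objects of \<open>Q\<close> is taken at their images under \<open>Fo\<close>.\<close>
  define Fm where "Fm = (\<lambda>\<beta> \<alpha>. inv_into (carrier (Hom B (Fo \<beta>) (Fo \<alpha>))) (Gm (Fo \<beta>) (Fo \<alpha>)))"
  have Fo: "Fo (Go x) = x" if "x \<in> Obj B" for x
    using bij_betw_inv_into_left[OF obj that] by (simp add: Fo_def)
  have Fm: "Fm (Go y) (Go x) (Gm y x f) = f"
    if "x \<in> Obj B" "y \<in> Obj B" "f \<in> carrier (Hom B y x)" for x y f
    using bij_betw_inv_into_left[OF hom] that by (simp add: Fm_def Fo)
  have F: "k_functor R Q B Fo Fm"
  proof (intro k_functor.intro k_functor_axioms.intro catQ B)
    fix x y assume "x \<in> Obj Q" "y \<in> Obj Q"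
    then show "Fm y x \<in> module_hom R (Hom Q y x) (Hom B (Fo y) (Fo x))"
      by (auto intro!: module_homI simp: Q homQ Fo Fm Glin Bmod)
  qed (auto simp: Q homQ Fo Fm comp[symmetric] idn[symmetric])
  have G: "k_functor R B Q Go Gm"
    by (intro k_functor.intro k_functor_axioms.intro catQ B) (auto simp: Q lin comp idn)
  have "k_category_iso R Q B Fo Fm"
    by (intro k_category_iso.intro k_category_iso_axioms.intro F exI[of _ Go] exI[of _ Gm])
      (auto simp: G Q homQ Fo Fm)
  then show ?thesis using Fo Fm by blast
qed

section \<open>Cosets of the kernel of a surjection\<close>

text \<open>The setting of the first isomorphism theorem. The quotient of \<open>X\<close> by the
  kernel of \<Phi> is compared with \<open>M\<close> through the fibres of \<Phi>, which are the
  cosets themselves as sets.\<close>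

locale module_surjection = X: module R X + M: module R M
  for R :: "('k, 'r) ring_scheme" and X :: "('k, 'x) module" and M :: "('k, 'm) module" +
  fixes \<Phi> :: "'x \<Rightarrow> 'm"
  assumes hom: "\<Phi> \<in> module_hom R X M" and surj: "carrier M \<subseteq> \<Phi> ` carrier X"
begin

definition fibre :: "'m \<Rightarrow> 'x set" where
  "fibre m = {v \<in> carrier X. \<Phi> v = m}"

lemma \<Phi>_simps [simp]:
  "v \<in> carrier X \<Longrightarrow> \<Phi> v \<in> carrier M"
  "\<lbrakk>v \<in> carrier X; w \<in> carrier X\<rbrakk> \<Longrightarrow> \<Phi> (v \<oplus>\<^bsub>X\<^esub> w) = \<Phi> v \<oplus>\<^bsub>M\<^esub> \<Phi> w"
  "\<lbrakk>a \<in> carrier R; v \<in> carrier X\<rbrakk> \<Longrightarrow> \<Phi> (a \<odot>\<^bsub>X\<^esub> v) = a \<odot>\<^bsub>M\<^esub> \<Phi> v"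
  "\<Phi> \<zero>\<^bsub>X\<^esub> = \<zero>\<^bsub>M\<^esub>"
  using module_homD[OF hom] module_hom_zero[OF X.module_axioms M.module_axioms hom] by auto

lemma \<Phi>_minus [simp]:
  assumes "v \<in> carrier X" shows "\<Phi> (\<ominus>\<^bsub>X\<^esub> v) = \<ominus>\<^bsub>M\<^esub> \<Phi> v"
  using assms \<Phi>_simps(2)[of "\<ominus>\<^bsub>X\<^esub> v" v]
  by (intro M.minus_equality[symmetric]) (auto simp: X.l_neg)

lemma fibre_nonempty:
  assumes "m \<in> carrier M" obtains v where "v \<in> carrier X" "\<Phi> v = m"
  using assms surj by blast

text \<open>If \<open>w\<close> and \<open>v\<close> have the same image, their difference lies in
  the kernel, and adding \<open>v\<close> back gives \<open>w\<close>.\<close>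

lemma coset_eq_fibre:
  assumes "v \<in> carrier X"
  shows "fibre \<zero>\<^bsub>M\<^esub> +>\<^bsub>X\<^esub> v = fibre (\<Phi> v)"
proof
  show "fibre \<zero>\<^bsub>M\<^esub> +>\<^bsub>X\<^esub> v \<subseteq> fibre (\<Phi> v)"
    using assms by (auto simp: a_r_coset_def' fibre_def)
  show "fibre (\<Phi> v) \<subseteq> fibre \<zero>\<^bsub>M\<^esub> +>\<^bsub>X\<^esub> v"
  proof
    fix w assume w: "w \<in> fibre (\<Phi> v)"
    then have "w \<ominus>\<^bsub>X\<^esub> v \<in> fibre \<zero>\<^bsub>M\<^esub>"
      using assms by (auto simp: fibre_def X.minus_eq M.r_neg)
    moreover have "w = (w \<ominus>\<^bsub>X\<^esub> v) \<oplus>\<^bsub>X\<^esub> v"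
      using assms w by (auto simp: fibre_def X.minus_eq X.a_assoc X.l_neg)
    ultimately show "w \<in> fibre \<zero>\<^bsub>M\<^esub> +>\<^bsub>X\<^esub> v" by (auto simp: a_r_coset_def')
  qed
qed

text \<open>Fibres over \<open>carrier M\<close> are nonempty, so a fibre determines its base point;
  by \<open>coset_eq_fibre\<close> they are exactly the cosets of the kernel.\<close>

lemma bij_betw_fibre:
  "bij_betw fibre (carrier M) (carrier (quotient_module X (fibre \<zero>\<^bsub>M\<^esub>)))"
proof -
  have "inj_on fibre (carrier M)"
  proof (rule inj_onI)
    fix m n assume "m \<in> carrier M" "fibre m = fibre n"
    then show "m = n" using fibre_nonempty[of m] by (auto simp: fibre_def)
  qed
  moreover have "a_rcosets\<^bsub>X\<^esub> (fibre \<zero>\<^bsub>M\<^esub>) = fibre ` carrier M"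
    by (auto simp: A_RCOSETS_def RCOSETS_def a_r_coset_def[symmetric] coset_eq_fibre
        elim!: fibre_nonempty)
  ultimately show ?thesis by (simp add: bij_betw_def quotient_module_def)
qed

text \<open>Addition of cosets is the sum of sets, and a scalar multiple is a union over
  representatives. Both have to be recognized as single fibres.\<close>

lemma fibre_hom: "fibre \<in> module_hom R M (quotient_module X (fibre \<zero>\<^bsub>M\<^esub>))"
proof (rule module_homI)
  show "fibre m \<in> carrier (quotient_module X (fibre \<zero>\<^bsub>M\<^esub>))" if "m \<in> carrier M" for m
    using bij_betw_fibre that by (auto simp: bij_betw_def)
next
  fix m n assume mn: "m \<in> carrier M" "n \<in> carrier M"
  have "fibre (m \<oplus>\<^bsub>M\<^esub> n) \<subseteq> set_add X (fibre m) (fibre n)"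
  proof
    fix w assume w: "w \<in> fibre (m \<oplus>\<^bsub>M\<^esub> n)"
    \<comment> \<open>Any preimage \<open>v\<close> of \<open>m\<close> splits \<open>w\<close> as
      \<open>v + (-v + w)\<close>, whose second part lies over \<open>n\<close>.\<close>
    obtain v where v: "v \<in> carrier X" "\<Phi> v = m" using fibre_nonempty mn by blast
    have "w = v \<oplus>\<^bsub>X\<^esub> (\<ominus>\<^bsub>X\<^esub> v \<oplus>\<^bsub>X\<^esub> w)"
      using w v by (auto simp: fibre_def X.a_assoc[symmetric] X.r_neg)
    moreover have "\<ominus>\<^bsub>X\<^esub> v \<oplus>\<^bsub>X\<^esub> w \<in> fibre n"
      using w v mn by (auto simp: fibre_def M.a_assoc[symmetric] M.l_neg)
    ultimately show "w \<in> set_add X (fibre m) (fibre n)"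
      using v unfolding set_add_def' by (auto simp: fibre_def)
  qed
  moreover have "set_add X (fibre m) (fibre n) \<subseteq> fibre (m \<oplus>\<^bsub>M\<^esub> n)"
    by (auto simp: set_add_def' fibre_def)
  ultimately show "fibre (m \<oplus>\<^bsub>M\<^esub> n) = fibre m \<oplus>\<^bsub>quotient_module X (fibre \<zero>\<^bsub>M\<^esub>)\<^esub> fibre n"
    by (simp add: quotient_module_def)
next
  fix a m assume a: "a \<in> carrier R" and m: "m \<in> carrier M"
  obtain v where v: "v \<in> carrier X" "\<Phi> v = m" using fibre_nonempty m by blast
  have "fibre \<zero>\<^bsub>M\<^esub> +>\<^bsub>X\<^esub> (a \<odot>\<^bsub>X\<^esub> w) = fibre (a \<odot>\<^bsub>M\<^esub> m)" if "w \<in> fibre m" for w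
    
  proof -
    have "w \<in> carrier X" "\<Phi> w = m" using that by (auto simp: fibre_def)
    then show ?thesis using a by (simp add: coset_eq_fibre)
  qed
  \<comment> \<open>The union of equal cosets is that coset because the fibre is nonempty.\<close>
  moreover have "v \<in> fibre m" using v by (simp add: fibre_def)
  ultimately show "fibre (a \<odot>\<^bsub>M\<^esub> m) = a \<odot>\<^bsub>quotient_module X (fibre \<zero>\<^bsub>M\<^esub>)\<^esub> fibre m"
    by (auto simp: quotient_module_def)
qed

end

section \<open>The augmentation submodule\<close>

text \<open>The element \<open>g - 1\<close> of the group algebra has augmentation zero and sends
  \<open>v\<close> to the difference of \<open>\<rho> g v\<close> and \<open>v\<close>.\<close>

lemma augmentation_submodule_contains:
  assumes X: "module R X" and G: "group G" and g: "g \<in> carrier G" and v: "v \<in> carrier X"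
    and \<rho>: "\<And>h. h \<in> carrier G \<Longrightarrow> \<rho> h v \<in> carrier X" and one: "\<rho> \<one>\<^bsub>G\<^esub> v = v"
  shows "\<rho> g v \<ominus>\<^bsub>X\<^esub> v \<in> augmentation_submodule R G X \<rho>"
proof -
  interpret X: module R X by fact
  interpret G: group G by fact
  show ?thesis
  \<comment> \<open>For \<open>g = 1\<close> the difference is zero. The case is separate because
    the coefficients 1 and -1 below need two distinct group elements.\<close>
  proof (cases "g = \<one>\<^bsub>G\<^esub>")
    case True
    have "\<zero>\<^bsub>X\<^esub> \<in> augmentation_submodule R G X \<rho>"
      unfolding augmentation_submodule_def using generate.one[of "add_monoid X"] by simp
    with True one v show ?thesis by (simp add: X.minus_eq X.r_neg)
  next
    case False
    \<comment> \<open>The group algebra element \<open>g - 1\<close>.\<close>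
    define a where "a = (\<lambda>h\<in>carrier G. if h = g then \<one>\<^bsub>R\<^esub> else if h = \<one>\<^bsub>G\<^esub> then \<ominus>\<^bsub>R\<^esub> \<one>\<^bsub>R\<^esub> else \<zero>\<^bsub>R\<^esub>)"
    let ?S = "{h \<in> carrier G. a h \<noteq> \<zero>\<^bsub>R\<^esub>}"
    \<comment> \<open>The inclusion is strict over the zero ring, where the support is
      empty.\<close>
    have S: "?S \<subseteq> {g, \<one>\<^bsub>G\<^esub>}" by (auto simp: a_def)
    have a_in: "a h \<in> carrier R" if "h \<in> carrier G" for h using that by (auto simp: a_def)
    have "augmentation R G a = (\<Oplus>\<^bsub>R\<^esub>h\<in>{g, \<one>\<^bsub>G\<^esub>}. a h)"
      unfolding augmentation_def
      by (rule X.R.add.finprod_mono_neutral_cong_left) (use S g a_in in auto)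
    also have "\<dots> = \<zero>\<^bsub>R\<^esub>"
      using False g by (simp add: a_def X.R.r_neg)
    finally have "augmentation R G a = \<zero>\<^bsub>R\<^esub>" .
    moreover have "a \<in> carrier (group_algebra R G)"
      using a_in finite_subset[OF S] by (auto simp: group_algebra_def a_def)
    ultimately have "a \<in> a_kernel (group_algebra R G) R (augmentation R G)"
      by (simp add: a_kernel_def kernel_def)
    moreover have "group_algebra_smult R G X \<rho> a v = \<rho> g v \<ominus>\<^bsub>X\<^esub> v"
    proof -
      have "group_algebra_smult R G X \<rho> a v = (\<Oplus>\<^bsub>X\<^esub>h\<in>{g, \<one>\<^bsub>G\<^esub>}. a h \<odot>\<^bsub>X\<^esub> \<rho> h v)"
        unfolding group_algebra_smult_def
        by (rule X.add.finprod_mono_neutral_cong_left) (use S g a_in \<rho> in auto)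
      also have "\<dots> = \<rho> g v \<ominus>\<^bsub>X\<^esub> v"
        using False g v \<rho>[OF g] one by (simp add: a_def X.minus_eq X.smult_l_minus)
      finally show ?thesis .
    qed
    ultimately show ?thesis
      unfolding augmentation_submodule_def 
      using v by (intro generate.incl CollectI exI[of _ a] exI[of _ v]) simp
  qed
qed

text \<open>For a linear map invariant under the group, the image of \<open>a v\<close> is
  \<epsilon>(a) times the image of \<open>v\<close>, which vanishes for \<open>a\<close> in the
  kernel of \<epsilon>. The kernel of \<Phi> is closed under sums and negatives, so it contains all
  that these elements generate.\<close>

lemma augmentation_submodule_subset_kernel:
  assumes X: "module R X" and M: "module R M" and \<Phi>: "\<Phi> \<in> module_hom R X M"
    and \<rho>: "\<And>g v. \<lbrakk>g \<in> carrier G; v \<in> carrier X\<rbrakk> \<Longrightarrow> \<rho> g v \<in> carrier X"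
    and inv: "\<And>g v. \<lbrakk>g \<in> carrier G; v \<in> carrier X\<rbrakk> \<Longrightarrow> \<Phi> (\<rho> g v) = \<Phi> v"
  shows "augmentation_submodule R G X \<rho> \<subseteq> {v \<in> carrier X. \<Phi> v = \<zero>\<^bsub>M\<^esub>}"
proof -
  interpret X: module R X by fact
  interpret M: module R M by fact
  have neg: "\<Phi> (\<ominus>\<^bsub>X\<^esub> v) = \<ominus>\<^bsub>M\<^esub> \<Phi> v" if "v \<in> carrier X" for v
    using module_homD(3)[OF \<Phi>, of "\<ominus>\<^bsub>R\<^esub> \<one>\<^bsub>R\<^esub>" v] that module_homD(1)[OF \<Phi> that]
    by (simp add: X.smult_l_minus M.smult_l_minus)
  have gen: "group_algebra_smult R G X \<rho> a v \<in> {v \<in> carrier X. \<Phi> v = \<zero>\<^bsub>M\<^esub>}"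
    if a: "a \<in> a_kernel (group_algebra R G) R (augmentation R G)" and v: "v \<in> carrier X" for a v
  proof -
    let ?S = "{g \<in> carrier G. a g \<noteq> \<zero>\<^bsub>R\<^esub>}"
    have aR: "\<And>g. g \<in> carrier G \<Longrightarrow> a g \<in> carrier R" and fin: "finite ?S"
      and aug: "(\<Oplus>\<^bsub>R\<^esub>g\<in>?S. a g) = \<zero>\<^bsub>R\<^esub>"
      using a by (auto simp: a_kernel_def kernel_def group_algebra_def augmentation_def)
    \<comment> \<open>Additivity in the scalar: it turns the sum of the \<open>a g \<Phi>(v)\<close>
      into \<epsilon>(a) times \<Phi>(v).\<close>
    have ev: "(\<lambda>c. c \<odot>\<^bsub>M\<^esub> w) (\<Oplus>\<^bsub>R\<^esub>g\<in>S. a g) = (\<Oplus>\<^bsub>M\<^esub>g\<in>S. a g \<odot>\<^bsub>M\<^esub> w)"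
      if "finite S" "S \<subseteq> carrier G" "w \<in> carrier M" for S w
      using that
    proof (induction S)
      case (insert g S)
      then show ?case using aR by (simp add: Pi_def M.smult_l_distr subset_eq)
    qed simp
    have "\<Phi> (group_algebra_smult R G X \<rho> a v) = (\<Oplus>\<^bsub>M\<^esub>g\<in>?S. \<Phi> (a g \<odot>\<^bsub>X\<^esub> \<rho> g v))"
      unfolding group_algebra_smult_def
      by (rule module_hom_finsum[OF X M \<Phi>]) (use aR \<rho> v in auto)
    also have "\<dots> = (\<Oplus>\<^bsub>M\<^esub>g\<in>?S. a g \<odot>\<^bsub>M\<^esub> \<Phi> v)"
      by (rule M.add.finprod_cong') (use aR \<rho> v inv module_homD[OF \<Phi>] in auto)
    also have "\<dots> = \<zero>\<^bsub>M\<^esub>"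
      using ev[OF fin, of "\<Phi> v"] aug v module_homD[OF \<Phi>] by simp
    finally show ?thesis
      unfolding group_algebra_smult_def using aR \<rho> v by auto
  qed
  show ?thesis
  proof
    fix v assume "v \<in> augmentation_submodule R G X \<rho>"
    then show "v \<in> {v \<in> carrier X. \<Phi> v = \<zero>\<^bsub>M\<^esub>}"
      unfolding augmentation_submodule_def
    proof (induction rule: generate.induct)
      case one
      then show ?case using module_hom_zero[OF X M \<Phi>] by simp
    next
      case (incl h)
      then show ?case using gen by auto
    next
      case (inv h)
      then have "h \<in> {v \<in> carrier X. \<Phi> v = \<zero>\<^bsub>M\<^esub>}" using gen by auto
      then show ?case using neg[of h] by (simp add: a_inv_def[symmetric])
    next
      case (eng h1 h2)
      then show ?case using module_homD(2)[OF \<Phi>] by auto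
    qed
  qed
qed

section \<open>Direct sums of submodules\<close>

text \<open>Restricting to the support keeps the sum finite for elements of a direct sum over an
  infinite index set.\<close>

definition family_sum :: "('k, 'm) module \<Rightarrow> 'i set \<Rightarrow> ('i \<Rightarrow> 'm) \<Rightarrow> 'm" where
  "family_sum N I v = (\<Oplus>\<^bsub>N\<^esub>i\<in>{i \<in> I. v i \<noteq> \<zero>\<^bsub>N\<^esub>}. v i)"

text \<open>The external direct sum of submodules of one module \<open>N\<close>. Different indices
  may carry the same submodule, so summing the entries in \<open>N\<close> is in general not
  injective.\<close>

locale submodule_family = N: module R N
  for R :: "('k, 'r) ring_scheme" and N :: "('k, 'm) module" +
  fixes I :: "'i set" and S :: "'i \<Rightarrow> 'm set" and M :: "'i \<Rightarrow> ('k, 'm) module"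
  assumes sub: "i \<in> I \<Longrightarrow> submodule (S i) R N"
    and fam: "i \<in> I \<Longrightarrow> M i = N\<lparr>carrier := S i\<rparr>"
begin

abbreviation X where "X \<equiv> direct_sum_module I M"

lemma S_closed [simp]:
  assumes "i \<in> I"
  shows "f \<in> S i \<Longrightarrow> f \<in> carrier N" "\<zero>\<^bsub>N\<^esub> \<in> S i"
    "\<lbrakk>f \<in> S i; g \<in> S i\<rbrakk> \<Longrightarrow> f \<oplus>\<^bsub>N\<^esub> g \<in> S i" "f \<in> S i \<Longrightarrow> \<ominus>\<^bsub>N\<^esub> f \<in> S i"
    "\<lbrakk>a \<in> carrier R; f \<in> S i\<rbrakk> \<Longrightarrow> a \<odot>\<^bsub>N\<^esub> f \<in> S i"
  using N.submoduleE[OF sub[OF assms]] submodule.axioms(1)[OF sub[OF assms]]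
  by (auto dest: subgroup.one_closed)

lemma carrier_X: "v \<in> carrier X \<longleftrightarrow> v \<in> (\<Pi>\<^sub>E i\<in>I. S i) \<and> finite {i \<in> I. v i \<noteq> \<zero>\<^bsub>N\<^esub>}"
proof -
  \<comment> \<open>\<open>carrier_sum_group\<close> describes the carrier once the summands are
    groups.\<close>
  have "group (add_monoid (M i))" if "i \<in> I" for i
  proof -
    interpret M: module R "M i"
      unfolding fam[OF that] by (rule submodule.submodule_is_module[OF sub[OF that] N.module_axioms])
    show ?thesis by (rule M.M.a_group)
  qed
  then have "carrier X = {v \<in> \<Pi>\<^sub>E i\<in>I. carrier (M i). finite {i \<in> I. v i \<noteq> \<zero>\<^bsub>M i\<^esub>}}"
    by (simp add: direct_sum_module_def carrier_sum_group)
  moreover have "{i \<in> I. v i \<noteq> \<zero>\<^bsub>M i\<^esub>} = {i \<in> I. v i \<noteq> \<zero>\<^bsub>N\<^esub>}" for v using fam by auto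
  ultimately show ?thesis using fam by (simp add: PiE_iff)
qed

lemma X_component [simp]: "\<lbrakk>v \<in> carrier X; i \<in> I\<rbrakk> \<Longrightarrow> v i \<in> S i"
  by (auto simp: carrier_X)

lemma X_finite [simp]: "v \<in> carrier X \<Longrightarrow> finite {i \<in> I. v i \<noteq> \<zero>\<^bsub>N\<^esub>}"
  by (auto simp: carrier_X)

lemma X_zero: "\<zero>\<^bsub>X\<^esub> = (\<lambda>i\<in>I. \<zero>\<^bsub>N\<^esub>)"
  using fam by (auto simp: direct_sum_module_def)

lemma X_add: "v \<oplus>\<^bsub>X\<^esub> w = (\<lambda>i\<in>I. v i \<oplus>\<^bsub>N\<^esub> w i)"
  using fam by (auto simp: direct_sum_module_def)

lemma X_smult: "a \<odot>\<^bsub>X\<^esub> v = (\<lambda>i\<in>I. a \<odot>\<^bsub>N\<^esub> v i)"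
  using fam by (auto simp: direct_sum_module_def)

lemma X_eqI:
  assumes "v \<in> carrier X" "w \<in> carrier X" "\<And>i. i \<in> I \<Longrightarrow> v i = w i"
  shows "v = w"
  using assms by (auto simp: carrier_X intro: PiE_ext)

lemma X_incl: "direct_sum_incl I M i f = (\<lambda>j\<in>I. if j = i then f else \<zero>\<^bsub>N\<^esub>)"
  using fam by (auto simp: direct_sum_incl_def)

text \<open>\<open>A\<close> is any finite set covering the support, so the exact support of a
  family need not be known.\<close>

lemma restrict_in_X:
  assumes "finite A" "\<And>i. i \<in> I \<Longrightarrow> f i \<in> S i" "\<And>i. \<lbrakk>i \<in> I; i \<notin> A\<rbrakk> \<Longrightarrow> f i = \<zero>\<^bsub>N\<^esub>"
  shows "(\<lambda>i\<in>I. f i) \<in> carrier X"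
proof -
  have "{i \<in> I. f i \<noteq> \<zero>\<^bsub>N\<^esub>} \<subseteq> A" using assms(3) by auto
  then have "finite {i \<in> I. f i \<noteq> \<zero>\<^bsub>N\<^esub>}" using assms(1) by (rule finite_subset)
  moreover have "{i \<in> I. restrict f I i \<noteq> \<zero>\<^bsub>N\<^esub>} = {i \<in> I. f i \<noteq> \<zero>\<^bsub>N\<^esub>}" by auto
  ultimately show ?thesis using assms(2) by (auto simp: carrier_X)
qed

lemma incl_closed [simp]: "f \<in> S i \<Longrightarrow> direct_sum_incl I M i f \<in> carrier X"
  unfolding X_incl by (rule restrict_in_X[of "{i}"]) auto

lemma zero_in_X: "(\<lambda>i\<in>I. \<zero>\<^bsub>N\<^esub>) \<in> carrier X"
  by (rule restrict_in_X[of "{}"]) auto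

lemma add_in_X:
  assumes "v \<in> carrier X" "w \<in> carrier X"
  shows "(\<lambda>i\<in>I. v i \<oplus>\<^bsub>N\<^esub> w i) \<in> carrier X"
  by (rule restrict_in_X[of "{i \<in> I. v i \<noteq> \<zero>\<^bsub>N\<^esub>} \<union> {i \<in> I. w i \<noteq> \<zero>\<^bsub>N\<^esub>}"]) (use assms in auto)

lemma smult_in_X:
  assumes "a \<in> carrier R" "v \<in> carrier X"
  shows "(\<lambda>i\<in>I. a \<odot>\<^bsub>N\<^esub> v i) \<in> carrier X"
  by (rule restrict_in_X[of "{i \<in> I. v i \<noteq> \<zero>\<^bsub>N\<^esub>}"]) (use assms in auto)

lemma minus_in_X:
  assumes "v \<in> carrier X"
  shows "(\<lambda>i\<in>I. \<ominus>\<^bsub>N\<^esub> v i) \<in> carrier X"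
  by (rule restrict_in_X[of "{i \<in> I. v i \<noteq> \<zero>\<^bsub>N\<^esub>}"]) (use assms in auto)

lemma X_in_N [simp]: "\<lbrakk>v \<in> carrier X; i \<in> I\<rbrakk> \<Longrightarrow> v i \<in> carrier N"
  using S_closed(1) X_component by blast

lemma module_X: "module R X"
proof (rule moduleI)
  show "cring R" by (rule N.is_cring)
  show "abelian_group X"
  proof (rule abelian_groupI)
    fix v assume v: "v \<in> carrier X"
    show "\<exists>w\<in>carrier X. w \<oplus>\<^bsub>X\<^esub> v = \<zero>\<^bsub>X\<^esub>"
      by (rule bexI[OF _ minus_in_X[OF v]]) (use v in \<open>auto simp: X_add X_zero N.l_neg\<close>)
    show "\<zero>\<^bsub>X\<^esub> \<oplus>\<^bsub>X\<^esub> v = v"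
    proof (rule X_eqI)
      show "\<zero>\<^bsub>X\<^esub> \<oplus>\<^bsub>X\<^esub> v \<in> carrier X"
        unfolding X_add X_zero by (intro add_in_X zero_in_X v)
    qed (use v in \<open>auto simp: X_add X_zero\<close>)
  qed (auto simp: X_add X_zero add_in_X zero_in_X N.a_assoc intro!: restrict_ext N.a_comm)
  fix v assume v: "v \<in> carrier X"
  show "\<one>\<^bsub>R\<^esub> \<odot>\<^bsub>X\<^esub> v = v"
    by (rule X_eqI) (use v smult_in_X in \<open>auto simp: X_smult\<close>)
qed (auto simp: X_add X_smult smult_in_X N.smult_l_distr N.smult_r_distr N.smult_assoc1
    intro!: restrict_ext)

text \<open>Zero entries contribute nothing; families with different supports can thus be summed
  over one common finite set.\<close>

lemma family_sum_eq:
  assumes "v \<in> carrier X" "finite A" "A \<subseteq> I" "\<And>i. \<lbrakk>i \<in> I; i \<notin> A\<rbrakk> \<Longrightarrow> v i = \<zero>\<^bsub>N\<^esub>"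
  shows "family_sum N I v = (\<Oplus>\<^bsub>N\<^esub>i\<in>A. v i)"
  unfolding family_sum_def
  by (rule N.add.finprod_mono_neutral_cong_left) (use assms in auto)

lemma family_sum_hom: "family_sum N I \<in> module_hom R X N"
proof (rule module_homI)
  fix v assume v: "v \<in> carrier X"
  then show "family_sum N I v \<in> carrier N"
    unfolding family_sum_def by (intro N.finsum_closed) auto
next
  fix v w assume v: "v \<in> carrier X" and w: "w \<in> carrier X"
  \<comment> \<open>Entries may cancel, so all three sums are taken over the union of the two
    supports.\<close>
  let ?A = "{i \<in> I. v i \<noteq> \<zero>\<^bsub>N\<^esub>} \<union> {i \<in> I. w i \<noteq> \<zero>\<^bsub>N\<^esub>}"
  have "family_sum N I (v \<oplus>\<^bsub>X\<^esub> w) = (\<Oplus>\<^bsub>N\<^esub>i\<in>?A. (v \<oplus>\<^bsub>X\<^esub> w) i)"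
    by (rule family_sum_eq) (use v w add_in_X in \<open>auto simp: X_add\<close>)
  also have "\<dots> = (\<Oplus>\<^bsub>N\<^esub>i\<in>?A. v i \<oplus>\<^bsub>N\<^esub> w i)"
    by (rule N.add.finprod_cong') (use v w in \<open>auto simp: X_add\<close>)
  also have "\<dots> = (\<Oplus>\<^bsub>N\<^esub>i\<in>?A. v i) \<oplus>\<^bsub>N\<^esub> (\<Oplus>\<^bsub>N\<^esub>i\<in>?A. w i)"
    by (rule N.add.finprod_multf) (use v w in auto)
  also have "(\<Oplus>\<^bsub>N\<^esub>i\<in>?A. v i) = family_sum N I v"
    by (rule family_sum_eq[symmetric]) (use v w in auto)
  also have "(\<Oplus>\<^bsub>N\<^esub>i\<in>?A. w i) = family_sum N I w"
    by (rule family_sum_eq[symmetric]) (use v w in auto)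
  finally show "family_sum N I (v \<oplus>\<^bsub>X\<^esub> w) = family_sum N I v \<oplus>\<^bsub>N\<^esub> family_sum N I w" .
next
  fix a v assume a: "a \<in> carrier R" and v: "v \<in> carrier X"
  let ?A = "{i \<in> I. v i \<noteq> \<zero>\<^bsub>N\<^esub>}"
  have "family_sum N I (a \<odot>\<^bsub>X\<^esub> v) = (\<Oplus>\<^bsub>N\<^esub>i\<in>?A. (a \<odot>\<^bsub>X\<^esub> v) i)"
    by (rule family_sum_eq) (use a v smult_in_X in \<open>auto simp: X_smult\<close>)
  also have "\<dots> = (\<Oplus>\<^bsub>N\<^esub>i\<in>?A. a \<odot>\<^bsub>N\<^esub> v i)"
    by (rule N.add.finprod_cong') (use a v in \<open>auto simp: X_smult\<close>)
  also have "\<dots> = a \<odot>\<^bsub>N\<^esub> family_sum N I v"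
    unfolding family_sum_def by (rule N.finsum_smult_ldistr[symmetric]) (use a v in auto)
  finally show "family_sum N I (a \<odot>\<^bsub>X\<^esub> v) = a \<odot>\<^bsub>N\<^esub> family_sum N I v" .
qed

lemma family_sum_incl:
  assumes "i \<in> I" "f \<in> S i"
  shows "family_sum N I (direct_sum_incl I M i f) = f"
proof -
  have "family_sum N I (direct_sum_incl I M i f) = (\<Oplus>\<^bsub>N\<^esub>j\<in>{i}. direct_sum_incl I M i f j)"
  proof (rule family_sum_eq)
    show "direct_sum_incl I M i f \<in> carrier X" using assms by simp
  qed (use assms in \<open>auto simp: X_incl\<close>)
  then show ?thesis using assms by (simp add: X_incl)
qed

text \<open>Induction on a finite set covering the support, splitting off one entry at a
  time.\<close>

lemma direct_sum_induct [consumes 1, case_names zero incl add]: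
  assumes "v \<in> carrier X"
    and zero: "P \<zero>\<^bsub>X\<^esub>"
    and incl: "\<And>i f. \<lbrakk>i \<in> I; f \<in> S i\<rbrakk> \<Longrightarrow> P (direct_sum_incl I M i f)"
    and add: "\<And>v w. \<lbrakk>v \<in> carrier X; w \<in> carrier X; P v; P w\<rbrakk> \<Longrightarrow> P (v \<oplus>\<^bsub>X\<^esub> w)"
  shows "P v"
proof -
  have "P v" if "finite A" "v \<in> carrier X" "\<And>i. \<lbrakk>i \<in> I; i \<notin> A\<rbrakk> \<Longrightarrow> v i = \<zero>\<^bsub>N\<^esub>" for A v
    using that
  proof (induction A arbitrary: v)
    case empty
    then have "v = \<zero>\<^bsub>X\<^esub>" by (intro X_eqI) (auto simp: X_zero zero_in_X)
    then show ?case using zero by simp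
  next
    case (insert k A)
    show ?case
    proof (cases "k \<in> I")
      case False
      then show ?thesis using insert by auto
    next
      case True
      \<comment> \<open>\<open>v\<close> with the entry at \<open>k\<close> erased: it vanishes
        outside \<open>A\<close>, and the inclusion of \<open>v k\<close> restores
        \<open>v\<close>.\<close>
      define w where "w = (\<lambda>i\<in>I. if i = k then \<zero>\<^bsub>N\<^esub> else v i)"
      have w: "w \<in> carrier X"
        unfolding w_def by (rule restrict_in_X[of A]) (use insert in auto)
      then have "P w" using insert by (intro insert.IH w) (auto simp: w_def)
      moreover have vk: "v k \<in> S k" using insert True by simp
      moreover have "v = direct_sum_incl I M k (v k) \<oplus>\<^bsub>X\<^esub> w"
      proof (rule X_eqI)
        show "direct_sum_incl I M k (v k) \<oplus>\<^bsub>X\<^esub> w \<in> carrier X"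
          unfolding X_add by (intro add_in_X incl_closed vk w)
      qed (use insert True in \<open>auto simp: X_add X_incl w_def\<close>)
      ultimately show ?thesis using add incl w True by (metis incl_closed)
    qed
  qed
  then show ?thesis using assms(1) X_finite[of v] by blast
qed

end

text \<open>Fubini for a finite rectangle; used additively for the double sum that defines the
  composite of two families.\<close>

lemma (in comm_monoid) finprod_Times:
  assumes "finite A" "finite C" "f \<in> A \<times> C \<rightarrow> carrier G"
  shows "(\<Otimes>p\<in>A \<times> C. f p) = (\<Otimes>a\<in>A. \<Otimes>c\<in>C. f (a, c))"
  using assms(1,3)
proof (induction A)
  case (insert a A)
  have "insert a A \<times> C = Pair a ` C \<union> A \<times> C" by auto
  then have "(\<Otimes>p\<in>insert a A \<times> C. f p) = (\<Otimes>p\<in>Pair a ` C. f p) \<otimes> (\<Otimes>p\<in>A \<times> C. f p)"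
    using insert assms(2) by (simp only:) (rule finprod_Un_disjoint, auto)
  also have "(\<Otimes>p\<in>Pair a ` C. f p) = (\<Otimes>c\<in>C. f (a, c))"
    by (rule finprod_reindex) (use insert in \<open>auto simp: inj_on_def\<close>)
  finally show ?case using insert by (auto simp: Pi_def)
qed simp

section \<open>Smash products\<close>

context graded_category
begin

abbreviation smash where "smash \<equiv> smash_product G B D"
abbreviation trans where "trans \<equiv> translation_obj G B"
abbreviation orb :: "'o \<Rightarrow> ('o \<times> 'g) set" where "orb x \<equiv> {x} \<times> carrier G"

section \<open>The smash product as a category\<close>

lemma Comp_closed:
  "\<lbrakk>x \<in> Obj B; y \<in> Obj B; z \<in> Obj B; f \<in> carrier (Hom B y x); g \<in> carrier (Hom B z y)\<rbrakk>
    \<Longrightarrow> Comp B z y x g f \<in> carrier (Hom B z x)"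
  by (rule module_homD(1)[OF comp_linear_left])

lemma degree_closed:
  assumes "x \<in> Obj B" "y \<in> Obj B" "s \<in> carrier G" "f \<in> D y x s"
  shows "f \<in> carrier (Hom B y x)"
  using module.submoduleE(1)[OF hom_module degree_submodule] assms by blast

lemma smash_simps [simp]:
  "Obj smash = Obj B \<times> carrier G"
  "Hom smash (y, t) (x, s) = (Hom B y x)\<lparr>carrier := D y x (inv\<^bsub>G\<^esub> t \<otimes>\<^bsub>G\<^esub> s)\<rparr>"
  "Comp smash (z, u) (y, t) (x, s) = Comp B z y x"
  "Idn smash (x, s) = Idn B x"
  by (auto simp: smash_product_def)

text \<open>The factor \<open>g\<close> cancels in the middle. This is why translation identifies
  morphism sets of the smash product that are literally equal.\<close>

lemma inv_mult_cancel:
  assumes "g \<in> carrier G" "s \<in> carrier G" "t \<in> carrier G"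
  shows "inv\<^bsub>G\<^esub> (g \<otimes>\<^bsub>G\<^esub> t) \<otimes>\<^bsub>G\<^esub> (g \<otimes>\<^bsub>G\<^esub> s) = inv\<^bsub>G\<^esub> t \<otimes>\<^bsub>G\<^esub> s"
  using assms by (simp add: G.inv_mult_group G.m_assoc) (simp add: G.m_assoc[symmetric])

text \<open>The degrees multiply to \<open>(u^-1 t)(t^-1 s) = u^-1 s\<close>, the degree required of
  a composite in the smash product.\<close>

lemma degree_comp':
  assumes "x \<in> Obj B" "y \<in> Obj B" "z \<in> Obj B" "s \<in> carrier G" "t \<in> carrier G" "u \<in> carrier G"
    "f \<in> D y x (inv\<^bsub>G\<^esub> t \<otimes>\<^bsub>G\<^esub> s)" "g \<in> D z y (inv\<^bsub>G\<^esub> u \<otimes>\<^bsub>G\<^esub> t)"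
  shows "Comp B z y x g f \<in> D z x (inv\<^bsub>G\<^esub> u \<otimes>\<^bsub>G\<^esub> s)"
proof -
  have "(inv\<^bsub>G\<^esub> u \<otimes>\<^bsub>G\<^esub> t) \<otimes>\<^bsub>G\<^esub> (inv\<^bsub>G\<^esub> t \<otimes>\<^bsub>G\<^esub> s) = inv\<^bsub>G\<^esub> u \<otimes>\<^bsub>G\<^esub> s"
    using assms by (simp add: G.m_assoc) (simp add: G.m_assoc[symmetric])
  then show ?thesis
    using degree_comp[of x y z "inv\<^bsub>G\<^esub> t \<otimes>\<^bsub>G\<^esub> s" "inv\<^bsub>G\<^esub> u \<otimes>\<^bsub>G\<^esub> t" f g] assms by simp
qed

text \<open>The laws are those of \<open>B\<close> on homogeneous morphisms. What remains is
  closure: \<open>degree_comp'\<close> for composites, and \<open>s^-1 s = 1\<close> for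
  identities.\<close>

lemma smash_category: "k_category R smash"
proof (intro k_category.intro k_category_axioms.intro)
  fix p q assume "p \<in> Obj smash" "q \<in> Obj smash"
  then show "module R (Hom smash q p)"
    by (auto intro!: submodule.submodule_is_module degree_submodule hom_module)
next
  fix p q r f assume "p \<in> Obj smash" "q \<in> Obj smash" "r \<in> Obj smash" "f \<in> carrier (Hom smash q p)"
  then show "(\<lambda>g. Comp smash r q p g f) \<in> module_hom R (Hom smash r q) (Hom smash r p)"
    by (auto intro!: module_homI module_homD(2,3)[OF comp_linear_left] elim!: degree_closed[rotated 3]
        intro: degree_comp')
next
  fix p q r g assume "p \<in> Obj smash" "q \<in> Obj smash" "r \<in> Obj smash" "g \<in> carrier (Hom smash r q)"
  then show "(\<lambda>f. Comp smash r q p g f) \<in> module_hom R (Hom smash q p) (Hom smash r p)"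
    by (auto intro!: module_homI module_homD(2,3)[OF comp_linear_right] elim!: degree_closed[rotated 3]
        intro: degree_comp')
next
  fix w p q r f g h
  assume "w \<in> Obj smash" "p \<in> Obj smash" "q \<in> Obj smash" "r \<in> Obj smash"
    "f \<in> carrier (Hom smash p w)" "g \<in> carrier (Hom smash q p)" "h \<in> carrier (Hom smash r q)"
  then show "Comp smash r p w (Comp smash r q p h g) f = Comp smash r q w h (Comp smash q p w g f)"
    by (auto intro!: comp_assoc elim!: degree_closed[rotated 3])
next
  fix p assume "p \<in> Obj smash"
  then show "Idn smash p \<in> carrier (Hom smash p p)"
    using degree_id by auto
next
  fix p q f assume "p \<in> Obj smash" "q \<in> Obj smash" "f \<in> carrier (Hom smash q p)"
  then show "Comp smash q q p (Idn smash q) f = f" "Comp smash q p p f (Idn smash p) = f"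
    by (auto intro!: id_left id_right elim!: degree_closed[rotated 3])
qed (rule is_cring)

section \<open>The translation action\<close>

lemma trans_simp [simp]: "\<lbrakk>x \<in> Obj B; s \<in> carrier G\<rbrakk> \<Longrightarrow> trans u (x, s) = (x, u \<otimes>\<^bsub>G\<^esub> s)"
  by (simp add: translation_obj_def)

text \<open>Translation by the inverse of \<open>u\<close> is the inverse map. \<open>Bij\<close>
  also asks for extensional maps, which the restriction in \<open>translation_obj\<close>
  provides.\<close>

lemma trans_Bij:
  assumes "u \<in> carrier G"
  shows "trans u \<in> Bij (Obj B \<times> carrier G)"
proof -
  have "bij_betw (trans u) (Obj B \<times> carrier G) (Obj B \<times> carrier G)"
    by (rule bij_betw_byWitness[where f' = "trans (inv\<^bsub>G\<^esub> u)"])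
      (use assms in \<open>auto simp: G.m_assoc[symmetric]\<close>)
  then show ?thesis by (auto simp: Bij_def translation_obj_def)
qed

lemma trans_action: "group_action G (Obj smash) trans"
proof -
  have "trans \<in> hom G (BijGroup (Obj smash))"
  proof (rule homI)
    fix u assume "u \<in> carrier G"
    then show "trans u \<in> carrier (BijGroup (Obj smash))" by (simp add: BijGroup_def trans_Bij)
  next
    fix u v assume uv: "u \<in> carrier G" "v \<in> carrier G"
    have "trans (u \<otimes>\<^bsub>G\<^esub> v) = compose (Obj B \<times> carrier G) (trans u) (trans v)"
    proof
      fix p show "trans (u \<otimes>\<^bsub>G\<^esub> v) p = compose (Obj B \<times> carrier G) (trans u) (trans v) p"
        using uv by (cases p) (auto simp: compose_def translation_obj_def G.m_assoc)
    qed
    then show "trans (u \<otimes>\<^bsub>G\<^esub> v) = trans u \<otimes>\<^bsub>BijGroup (Obj smash)\<^esub> trans v"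
      using uv by (simp add: BijGroup_def trans_Bij)
  qed
  then show ?thesis
    by (intro group_action.intro group_hom.intro group_hom_axioms.intro G.is_group group_BijGroup)
qed

text \<open>Translation is the identity on underlying morphisms, between equal sets by
  \<open>inv_mult_cancel\<close>. Freeness is cancellation in the group: \<open>u s = s\<close>
  forces \<open>u = 1\<close>.\<close>

lemma smash_free_G_category: "free_G_category R G smash trans translation_mor"
proof (intro free_G_category.intro free_G_category_axioms.intro G_category.intro
    G_category_axioms.intro smash_category trans_action G.is_group)
  fix s p q assume "s \<in> carrier G" "p \<in> Obj smash" "q \<in> Obj smash"
  then show "translation_mor s q p \<in> module_hom R (Hom smash q p) (Hom smash (trans s q) (trans s p))"
    by (auto intro!: module_homI simp: translation_mor_def inv_mult_cancel)
next
  fix p assume "p \<in> Obj smash"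
  then show "stabilizer G trans p = {\<one>\<^bsub>G\<^esub>}"
    by (auto simp: stabilizer_def)
qed (auto simp: translation_mor_def)

text \<open>The group acts transitively on the second coordinate, since \<open>r s^-1\<close>
  carries \<open>s\<close> to \<open>r\<close>.\<close>

lemma trans_orbit:
  assumes "x \<in> Obj B" "s \<in> carrier G"
  shows "orbit G trans (x, s) = orb x"
proof -
  have "(x, r) \<in> orbit G trans (x, s)" if "r \<in> carrier G" for r
    unfolding orbit_def using assms that
    by (auto intro!: exI[of _ "r \<otimes>\<^bsub>G\<^esub> inv\<^bsub>G\<^esub> s"] simp: G.m_assoc)
  then show ?thesis using assms by (auto simp: orbit_def)
qed


subsection \<open>Morphisms between two orbits\<close>

text \<open>The index is a pair (target, source). On \<open>orb y \<times> orb x\<close> the object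
  parts are constant, so only the group parts enter.\<close>

definition orb_deg :: "'o \<Rightarrow> 'o \<Rightarrow> ('o \<times> 'g) \<times> ('o \<times> 'g) \<Rightarrow> 'm set" where
  "orb_deg y x = (\<lambda>((_, t), (_, s)). D y x (inv\<^bsub>G\<^esub> t \<otimes>\<^bsub>G\<^esub> s))"

abbreviation orb_homs where "orb_homs y x \<equiv> orbit_homs smash (orb y) (orb x)"
abbreviation orb_sum where "orb_sum y x \<equiv> family_sum (Hom B y x) (orb y \<times> orb x)"
abbreviation orb_kernel where
  "orb_kernel y x \<equiv> orbit_homs_kernel R G smash trans translation_mor (orb y) (orb x)"
abbreviation orb_act where
  "orb_act y x \<equiv> orbit_homs_action G trans translation_mor (orb y) (orb x)"

lemma orb_deg_simp [simp]: "orb_deg y x ((y', t), (x', s)) = D y x (inv\<^bsub>G\<^esub> t \<otimes>\<^bsub>G\<^esub> s)"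
  by (simp add: orb_deg_def)

lemma orb_family:
  assumes "x \<in> Obj B" "y \<in> Obj B"
  shows "submodule_family R (Hom B y x) (orb y \<times> orb x) (orb_deg y x) (\<lambda>(q, p). Hom smash q p)"
  using assms
  by (intro submodule_family.intro submodule_family_axioms.intro hom_module)
    (auto intro!: degree_submodule)

definition shift :: "'g \<Rightarrow> ('o \<times> 'g) \<times> ('o \<times> 'g) \<Rightarrow> ('o \<times> 'g) \<times> ('o \<times> 'g)" where
  "shift g = (\<lambda>((y, t), (x, s)). ((y, g \<otimes>\<^bsub>G\<^esub> t), (x, g \<otimes>\<^bsub>G\<^esub> s)))"

text \<open>Translation does not change the underlying morphism of \<open>B\<close>, so the action
  only permutes the entries of a family.\<close>

lemma orb_act_eq:
  assumes "x \<in> Obj B" "y \<in> Obj B" "g \<in> carrier G"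
  shows "orb_act y x g v = (\<lambda>i\<in>orb y \<times> orb x. v (shift (inv\<^bsub>G\<^esub> g) i))"
  using assms by (auto simp: orbit_homs_action_def translation_mor_def shift_def intro!: restrict_ext)

lemma shift_cancel:
  assumes "g \<in> carrier G" "i \<in> orb y \<times> orb x"
  shows "shift g (shift (inv\<^bsub>G\<^esub> g) i) = i" "shift (inv\<^bsub>G\<^esub> g) (shift g i) = i"
    "shift g i \<in> orb y \<times> orb x" "shift (inv\<^bsub>G\<^esub> g) i \<in> orb y \<times> orb x"
    "orb_deg y x (shift g i) = orb_deg y x i" "orb_deg y x (shift (inv\<^bsub>G\<^esub> g) i) = orb_deg y x i"
  using assms by (auto simp: shift_def inv_mult_cancel) (simp_all add: G.m_assoc[symmetric])

context
  fixes x y assumes xy: "x \<in> Obj B" "y \<in> Obj B"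
begin

interpretation F: submodule_family R "Hom B y x" "orb y \<times> orb x" "orb_deg y x" "\<lambda>(q, p). Hom smash q p"
  by (rule orb_family[OF xy])

lemma orb_homs_eq: "orb_homs y x = F.X"
  by (simp add: orbit_homs_def)

lemma orb_homs_incl_eq:
  "orbit_homs_incl smash (orb y) (orb x) q p f
    = direct_sum_incl (orb y \<times> orb x) (\<lambda>(q, p). Hom smash q p) (q, p) f"
  by (simp add: orbit_homs_incl_def)

lemma module_orb_homs: "module R (orb_homs y x)"
  using F.module_X by (simp add: orb_homs_eq)

lemma orb_sum_hom: "orb_sum y x \<in> module_hom R (orb_homs y x) (Hom B y x)"
  using F.family_sum_hom by (simp add: orb_homs_eq)

lemma orb_incl:
  assumes "t \<in> carrier G" "s \<in> carrier G" "f \<in> D y x (inv\<^bsub>G\<^esub> t \<otimes>\<^bsub>G\<^esub> s)"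
  shows "orbit_homs_incl smash (orb y) (orb x) (y, t) (x, s) f \<in> carrier (orb_homs y x)"
    "orb_sum y x (orbit_homs_incl smash (orb y) (orb x) (y, t) (x, s) f) = f"
  using assms by (auto simp: orb_homs_eq orb_homs_incl_eq F.family_sum_incl)

text \<open>Existence of homogeneous decompositions: the component of degree \<open>r\<close> is
  placed at target \<open>(y, 1)\<close> and source \<open>(x, r)\<close>, where the required degree
  is \<open>r\<close>.\<close>

lemma orb_sum_surj: "carrier (Hom B y x) \<subseteq> orb_sum y x ` carrier (orb_homs y x)"
proof
  fix m assume "m \<in> carrier (Hom B y x)"
  then have "\<exists>!c. c \<in> (\<Pi>\<^sub>E r\<in>carrier G. D y x r) \<and>
      finite {r \<in> carrier G. c r \<noteq> \<zero>\<^bsub>Hom B y x\<^esub>} \<and>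
      m = (\<Oplus>\<^bsub>Hom B y x\<^esub>r\<in>{r \<in> carrier G. c r \<noteq> \<zero>\<^bsub>Hom B y x\<^esub>}. c r)"
    using degree_direct_sum[OF xy] by (simp add: internal_direct_sum_def)
  then obtain c where c: "c \<in> (\<Pi>\<^sub>E r\<in>carrier G. D y x r)"
    and m: "m = (\<Oplus>\<^bsub>Hom B y x\<^esub>r\<in>{r \<in> carrier G. c r \<noteq> \<zero>\<^bsub>Hom B y x\<^esub>}. c r)"
    by blast
  let ?A = "{r \<in> carrier G. c r \<noteq> \<zero>\<^bsub>Hom B y x\<^esub>}"
  let ?i = "\<lambda>r. orbit_homs_incl smash (orb y) (orb x) (y, \<one>\<^bsub>G\<^esub>) (x, r) (c r)"
  have i: "?i r \<in> carrier (orb_homs y x)" "orb_sum y x (?i r) = c r" if "r \<in> carrier G" for r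
    using orb_incl[of "\<one>\<^bsub>G\<^esub>" r "c r"] that c by auto
  have cN: "c r \<in> carrier (Hom B y x)" if "r \<in> carrier G" for r
    using degree_closed[OF xy that] that c by auto
  interpret X: module R "orb_homs y x" by (rule module_orb_homs)
  have "orb_sum y x (\<Oplus>\<^bsub>orb_homs y x\<^esub>r\<in>?A. ?i r) = (\<Oplus>\<^bsub>Hom B y x\<^esub>r\<in>?A. orb_sum y x (?i r))"
    by (rule module_hom_finsum[OF module_orb_homs F.N.module_axioms orb_sum_hom]) (use i in auto)
  also have "\<dots> = m"
    unfolding m using i cN by (intro F.N.add.finprod_cong') auto
  finally have "m = orb_sum y x (\<Oplus>\<^bsub>orb_homs y x\<^esub>r\<in>?A. ?i r)" ..
  moreover have "(\<Oplus>\<^bsub>orb_homs y x\<^esub>r\<in>?A. ?i r) \<in> carrier (orb_homs y x)"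
    using i by (intro X.finsum_closed) auto
  ultimately show "m \<in> orb_sum y x ` carrier (orb_homs y x)" by blast
qed

lemma orb_surjection: "module_surjection R (orb_homs y x) (Hom B y x) (orb_sum y x)"
  by (intro module_surjection.intro module_surjection_axioms.intro module_orb_homs
      hom_module xy orb_sum_hom orb_sum_surj)

section \<open>Invariance of the sum map\<close>

text \<open>The shift keeps degrees and carries the finite support to a finite set.\<close>

lemma orb_act_closed:
  assumes g: "g \<in> carrier G" and v: "v \<in> carrier (orb_homs y x)"
  shows "orb_act y x g v \<in> carrier (orb_homs y x)"
proof -
  let ?A = "{i \<in> orb y \<times> orb x. v i \<noteq> \<zero>\<^bsub>Hom B y x\<^esub>}"
  have v': "v \<in> carrier F.X" using v by (simp add: orb_homs_eq)
  have "v (shift (inv\<^bsub>G\<^esub> g) i) = \<zero>\<^bsub>Hom B y x\<^esub>" if "i \<in> orb y \<times> orb x" "i \<notin> shift g ` ?A" for i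
    using that shift_cancel[OF g that(1)] by force
  moreover have "v (shift (inv\<^bsub>G\<^esub> g) i) \<in> orb_deg y x i" if "i \<in> orb y \<times> orb x" for i
    using F.X_component[OF v', of "shift (inv\<^bsub>G\<^esub> g) i"] shift_cancel[OF g that] by simp
  ultimately show ?thesis
    unfolding orb_act_eq[OF xy g] orb_homs_eq
    by (intro F.restrict_in_X[of "shift g ` ?A"]) (use F.X_finite[OF v'] in blast)+
qed

text \<open>Both sums have the same terms, reindexed along the injective shift by
  \<open>g\<close>.\<close>

lemma orb_sum_act:
  assumes g: "g \<in> carrier G" and v: "v \<in> carrier (orb_homs y x)"
  shows "orb_sum y x (orb_act y x g v) = orb_sum y x v"
proof -
  let ?A = "{i \<in> orb y \<times> orb x. v i \<noteq> \<zero>\<^bsub>Hom B y x\<^esub>}"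
  have v': "v \<in> carrier F.X" using v by (simp add: orb_homs_eq)
  have zero: "orb_act y x g v i = \<zero>\<^bsub>Hom B y x\<^esub>" if "i \<in> orb y \<times> orb x" "i \<notin> shift g ` ?A" for i
  proof -
    have "v (shift (inv\<^bsub>G\<^esub> g) i) = \<zero>\<^bsub>Hom B y x\<^esub>"
      using that shift_cancel[OF g that(1)] by force
    then show ?thesis using that(1) by (simp add: orb_act_eq[OF xy g])
  qed
  have sub: "shift g ` ?A \<subseteq> orb y \<times> orb x" using shift_cancel(3)[OF g] by blast
  have act: "orb_act y x g v (shift g i) = v i" if "i \<in> ?A" for i
  proof -
    have i: "i \<in> orb y \<times> orb x" using that by simp
    show ?thesis
      unfolding orb_act_eq[OF xy g] by (simp only: restrict_apply' shift_cancel(2,3)[OF g i])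
  qed
  have av: "orb_act y x g v \<in> carrier F.X" using orb_act_closed[OF assms] by (simp add: orb_homs_eq)
  have "orb_sum y x (orb_act y x g v) = (\<Oplus>\<^bsub>Hom B y x\<^esub>i\<in>shift g ` ?A. orb_act y x g v i)"
    by (rule F.family_sum_eq[OF av finite_imageI[OF F.X_finite[OF v']] sub zero])
  also have "\<dots> = (\<Oplus>\<^bsub>Hom B y x\<^esub>i\<in>?A. orb_act y x g v (shift g i))"
  proof (rule F.N.finsum_reindex)
    show "orb_act y x g v \<in> shift g ` ?A \<rightarrow> carrier (Hom B y x)"
      by (intro Pi_I F.X_in_N[OF av] subsetD[OF sub])
    show "inj_on (shift g) ?A"
      by (rule inj_on_inverseI[of _ "shift (inv\<^bsub>G\<^esub> g)"]) (rule shift_cancel(2)[OF g, of _ y x], simp)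
  qed
  also have "\<dots> = orb_sum y x v"
    unfolding family_sum_def
  proof (rule F.N.add.finprod_cong'[OF refl _ act])
    show "v \<in> ?A \<rightarrow> carrier (Hom B y x)" using F.X_in_N[OF v'] by (intro Pi_I) simp
  qed
  finally show ?thesis .
qed

lemma orb_act_one:
  assumes v: "v \<in> carrier (orb_homs y x)"
  shows "orb_act y x \<one>\<^bsub>G\<^esub> v = v"
proof (rule F.X_eqI)
  show "orb_act y x \<one>\<^bsub>G\<^esub> v \<in> carrier F.X" "v \<in> carrier F.X"
    using orb_act_closed[OF G.one_closed v] v by (simp_all only: orb_homs_eq)
  fix i assume i: "i \<in> orb y \<times> orb x"
  then have "shift (inv\<^bsub>G\<^esub> \<one>\<^bsub>G\<^esub>) i = i" by (auto simp: shift_def)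
  then show "orb_act y x \<one>\<^bsub>G\<^esub> v i = v i"
    using i by (simp only: orb_act_eq[OF xy G.one_closed] restrict_apply')
qed

section \<open>The kernel of the sum map is the augmentation submodule\<close>

lemma orb_kernel_subset:
  "orb_kernel y x \<subseteq> {v \<in> carrier (orb_homs y x). orb_sum y x v = \<zero>\<^bsub>Hom B y x\<^esub>}"
  unfolding orbit_homs_kernel_def
  by (rule augmentation_submodule_subset_kernel[where \<rho> = "orb_act y x",
      OF module_orb_homs F.N.module_axioms orb_sum_hom orb_act_closed orb_sum_act])

text \<open>Generators inside the carrier generate a subgroup. Its closure under sums and negatives
  is what the reduction to normal form relies on.\<close>

lemma orb_kernel_subgroup: "subgroup (orb_kernel y x) (add_monoid (orb_homs y x))"
proof -
  interpret X: module R "orb_homs y x" by (rule module_orb_homs)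
  have smult: "group_algebra_smult R G (orb_homs y x) (orb_act y x) a v \<in> carrier (orb_homs y x)"
    if "a \<in> carrier (group_algebra R G)" "v \<in> carrier (orb_homs y x)" for a v
    unfolding group_algebra_smult_def
  proof (intro X.finsum_closed Pi_I X.smult_closed orb_act_closed that(2))
    fix g assume "g \<in> {g \<in> carrier G. a g \<noteq> \<zero>\<^bsub>R\<^esub>}"
    then show "a g \<in> carrier R" "g \<in> carrier G" using that(1) by (auto simp: group_algebra_def)
  qed
  show ?thesis
    unfolding orbit_homs_kernel_def augmentation_submodule_def
  proof (rule X.add.generate_is_subgroup, intro subsetI, elim CollectE exE conjE)
    fix w a v assume "w = group_algebra_smult R G (orb_homs y x) (orb_act y x) a v"
      "a \<in> a_kernel (group_algebra R G) R (augmentation R G)" "v \<in> carrier (orb_homs y x)"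
    then show "w \<in> carrier (orb_homs y x)"
      using smult by (simp add: a_kernel_def kernel_def)
  qed
qed

text \<open>A family with one entry, at target \<open>(y, t)\<close>, is translated by
  \<open>t^-1\<close> to one with target \<open>(y, 1)\<close>, which changes it by an element of
  the kernel. Both requirements on \<open>w\<close> survive addition, so induction over the direct
  sum gives the rest.\<close>

lemma orb_normal_form:
  assumes "v \<in> carrier (orb_homs y x)"
  shows "\<exists>w\<in>carrier (orb_homs y x).
    (\<forall>t\<in>carrier G. \<forall>s\<in>carrier G. t \<noteq> \<one>\<^bsub>G\<^esub> \<longrightarrow> w ((y, t), (x, s)) = \<zero>\<^bsub>Hom B y x\<^esub>) \<and>
    w \<ominus>\<^bsub>orb_homs y x\<^esub> v \<in> orb_kernel y x"
  using assms unfolding orb_homs_eq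
proof (induction rule: F.direct_sum_induct)
  interpret X: module R F.X by (rule F.module_X)
  interpret K: subgroup "orb_kernel y x" "add_monoid F.X"
    using orb_kernel_subgroup by (simp add: orb_homs_eq)
  {
    case zero
    have "\<zero>\<^bsub>F.X\<^esub> \<ominus>\<^bsub>F.X\<^esub> \<zero>\<^bsub>F.X\<^esub> \<in> orb_kernel y x"
      using K.one_closed by (simp del: X.M.l_zero X.M.r_zero add: X.minus_eq X.r_neg)
    moreover have "\<zero>\<^bsub>F.X\<^esub> ((y, t), (x, s)) = \<zero>\<^bsub>Hom B y x\<^esub>"
      if "t \<in> carrier G" "s \<in> carrier G" for t s
      using that by (simp add: F.X_zero)
    ultimately show ?case using X.zero_closed by blast
  next
    case (incl i f)
    then obtain t s where i: "i = ((y, t), (x, s))" and ts: "t \<in> carrier G" "s \<in> carrier G" by auto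
    let ?v = "direct_sum_incl (orb y \<times> orb x) (\<lambda>(q, p). Hom smash q p) i f"
    let ?w = "orb_act y x (inv\<^bsub>G\<^esub> t) ?v"
    have v: "?v \<in> carrier (orb_homs y x)" using incl by (simp add: orb_homs_eq)
    have "?w \<ominus>\<^bsub>orb_homs y x\<^esub> ?v \<in> orb_kernel y x"
      unfolding orbit_homs_kernel_def
    proof (rule augmentation_submodule_contains[where \<rho> = "orb_act y x", OF module_orb_homs G.is_group])
      show "inv\<^bsub>G\<^esub> t \<in> carrier G" using ts by simp
    qed (rule v orb_act_closed[OF _ v] orb_act_one[OF v], assumption?)+
    moreover have "?w \<in> carrier F.X" using orb_act_closed v ts by (simp add: orb_homs_eq)
    moreover have "?w ((y, t'), (x, s')) = \<zero>\<^bsub>Hom B y x\<^esub>"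
      if "t' \<in> carrier G" "s' \<in> carrier G" "t' \<noteq> \<one>\<^bsub>G\<^esub>" for t' s'
      using that ts by (auto simp: orb_act_eq[OF xy] shift_def F.X_incl i)
    ultimately show ?case by (auto simp: orb_homs_eq)
  next
    case (add v1 v2)
    then obtain w1 w2 where w: "w1 \<in> carrier F.X" "w2 \<in> carrier F.X"
      "w1 \<ominus>\<^bsub>F.X\<^esub> v1 \<in> orb_kernel y x" "w2 \<ominus>\<^bsub>F.X\<^esub> v2 \<in> orb_kernel y x"
      and z: "\<forall>t\<in>carrier G. \<forall>s\<in>carrier G. t \<noteq> \<one>\<^bsub>G\<^esub> \<longrightarrow> w1 ((y, t), (x, s)) = \<zero>\<^bsub>Hom B y x\<^esub>"
        "\<forall>t\<in>carrier G. \<forall>s\<in>carrier G. t \<noteq> \<one>\<^bsub>G\<^esub> \<longrightarrow> w2 ((y, t), (x, s)) = \<zero>\<^bsub>Hom B y x\<^esub>"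
      by blast
    have "(w1 \<oplus>\<^bsub>F.X\<^esub> w2) \<ominus>\<^bsub>F.X\<^esub> (v1 \<oplus>\<^bsub>F.X\<^esub> v2) = (w1 \<ominus>\<^bsub>F.X\<^esub> v1) \<oplus>\<^bsub>F.X\<^esub> (w2 \<ominus>\<^bsub>F.X\<^esub> v2)"
      using add w by (simp add: X.minus_eq X.minus_add X.a_ac)
    then have "(w1 \<oplus>\<^bsub>F.X\<^esub> w2) \<ominus>\<^bsub>F.X\<^esub> (v1 \<oplus>\<^bsub>F.X\<^esub> v2) \<in> orb_kernel y x"
      using K.m_closed[OF w(3,4)] by simp
    moreover have "w1 \<oplus>\<^bsub>F.X\<^esub> w2 \<in> carrier F.X" using w by simp
    moreover have "(w1 \<oplus>\<^bsub>F.X\<^esub> w2) ((y, t), (x, s)) = \<zero>\<^bsub>Hom B y x\<^esub>"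
      if "t \<in> carrier G" "s \<in> carrier G" "t \<noteq> \<one>\<^bsub>G\<^esub>" for t s
      using z that by (simp add: F.X_add)
    ultimately show ?case by blast
  }
qed

text \<open>Uniqueness of homogeneous decompositions: with the target fixed at \<open>(y, 1)\<close>
  the entries have pairwise different degrees, so they form a decomposition of zero and all
  vanish.\<close>

lemma orb_sum_inj_normal:
  assumes w: "w \<in> carrier (orb_homs y x)"
    and normal: "\<And>t s. \<lbrakk>t \<in> carrier G; s \<in> carrier G; t \<noteq> \<one>\<^bsub>G\<^esub>\<rbrakk> \<Longrightarrow> w ((y, t), (x, s)) = \<zero>\<^bsub>Hom B y x\<^esub>"
    and sum: "orb_sum y x w = \<zero>\<^bsub>Hom B y x\<^esub>"
  shows "w = \<zero>\<^bsub>orb_homs y x\<^esub>"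
proof -
  have w': "w \<in> carrier F.X" using w by (simp add: orb_homs_eq)
  let ?j = "\<lambda>r. ((y, \<one>\<^bsub>G\<^esub>), (x, r))"
  \<comment> \<open>The row with target \<open>(y, 1)\<close>, indexed by degree; \<open>c0\<close>
    is the trivial decomposition it is compared with.\<close>
  define c where "c = (\<lambda>r\<in>carrier G. w (?j r))"
  define c0 where "c0 = (\<lambda>r\<in>carrier G. \<zero>\<^bsub>Hom B y x\<^esub>)"
  let ?A = "{r \<in> carrier G. c r \<noteq> \<zero>\<^bsub>Hom B y x\<^esub>}"
  have comp: "w (?j r) \<in> D y x r" if "r \<in> carrier G" for r
    using F.X_component[OF w', of "?j r"] that by simp
  have compN: "w (?j r) \<in> carrier (Hom B y x)" if "r \<in> carrier G" for r
    by (rule degree_closed[OF xy that comp[OF that]])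
  have "finite (?j ` ?A)"
    by (rule finite_subset[OF _ F.X_finite[OF w']]) (auto simp: c_def)
  then have fin: "finite ?A" by (rule finite_imageD) (auto simp: inj_on_def)
  have "orb_sum y x w = (\<Oplus>\<^bsub>Hom B y x\<^esub>i\<in>?j ` ?A. w i)"
  proof (rule F.family_sum_eq[OF w'])
    fix i assume i: "i \<in> orb y \<times> orb x" "i \<notin> ?j ` ?A"
    then obtain t s where ts: "i = ((y, t), (x, s))" "t \<in> carrier G" "s \<in> carrier G" by auto
    with i(2) have "t = \<one>\<^bsub>G\<^esub> \<Longrightarrow> c s = \<zero>\<^bsub>Hom B y x\<^esub>" by blast
    then show "w i = \<zero>\<^bsub>Hom B y x\<^esub>" using normal ts by (cases "t = \<one>\<^bsub>G\<^esub>") (auto simp: c_def)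
  qed (use fin in auto)
  also have "\<dots> = (\<Oplus>\<^bsub>Hom B y x\<^esub>r\<in>?A. w (?j r))"
  proof (rule F.N.finsum_reindex)
    show "w \<in> ?j ` ?A \<rightarrow> carrier (Hom B y x)" using compN by blast
  qed (simp add: inj_on_def)
  also have "\<dots> = (\<Oplus>\<^bsub>Hom B y x\<^esub>r\<in>?A. c r)"
    by (rule F.N.add.finprod_cong') (use compN in \<open>simp_all add: c_def\<close>)
  finally have sum_c: "\<zero>\<^bsub>Hom B y x\<^esub> = (\<Oplus>\<^bsub>Hom B y x\<^esub>r\<in>?A. c r)" using sum by simp
  have c: "c \<in> (\<Pi>\<^sub>E r\<in>carrier G. D y x r)" using comp by (simp add: c_def)
  have "\<zero>\<^bsub>Hom B y x\<^esub> \<in> D y x r" if "r \<in> carrier G" for r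
    using F.S_closed(2)[of "?j r"] that by simp
  then have c0: "c0 \<in> (\<Pi>\<^sub>E r\<in>carrier G. D y x r)" by (simp add: c0_def)
  have unique: "a = b" if "\<exists>!c. P c" "P a" "P b" for P and a b :: "'g \<Rightarrow> 'm"
    using that by blast
  have supp0: "{r \<in> carrier G. c0 r \<noteq> \<zero>\<^bsub>Hom B y x\<^esub>} = {}" by (auto simp: c0_def)
  have "\<exists>!c. c \<in> (\<Pi>\<^sub>E r\<in>carrier G. D y x r) \<and>
      finite {r \<in> carrier G. c r \<noteq> \<zero>\<^bsub>Hom B y x\<^esub>} \<and>
      \<zero>\<^bsub>Hom B y x\<^esub> = (\<Oplus>\<^bsub>Hom B y x\<^esub>r\<in>{r \<in> carrier G. c r \<noteq> \<zero>\<^bsub>Hom B y x\<^esub>}. c r)"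
    using degree_direct_sum[OF xy] F.N.zero_closed unfolding internal_direct_sum_def by (rule bspec)
  then have "c = c0"
    by (rule unique) (intro conjI c fin sum_c, unfold supp0, simp add: c0)
  have zero: "w (?j r) = \<zero>\<^bsub>Hom B y x\<^esub>" if "r \<in> carrier G" for r
    using that fun_cong[OF \<open>c = c0\<close>, of r] by (simp add: c_def c0_def)
  show ?thesis
    unfolding orb_homs_eq F.X_zero
  proof (rule F.X_eqI[OF w' F.zero_in_X])
    fix i assume i: "i \<in> orb y \<times> orb x"
    then obtain t s where "i = ((y, t), (x, s))" "t \<in> carrier G" "s \<in> carrier G" by auto
    then show "w i = (\<lambda>i\<in>orb y \<times> orb x. \<zero>\<^bsub>Hom B y x\<^esub>) i"
      using zero normal i by (cases "t = \<one>\<^bsub>G\<^esub>") auto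
  qed
qed

text \<open>Let \<open>v\<close> have sum zero and normal form \<open>w\<close>. Their difference
  lies in \<open>orb_kernel\<close>, so \<open>w\<close> has sum zero as well and hence vanishes;
  thus \<open>-v\<close>, and with it \<open>v\<close>, lies in \<open>orb_kernel\<close>.\<close>

lemma orb_kernel_eq:
  "orb_kernel y x = {v \<in> carrier (orb_homs y x). orb_sum y x v = \<zero>\<^bsub>Hom B y x\<^esub>}"
proof
  interpret X: module R "orb_homs y x" by (rule module_orb_homs)
  interpret K: subgroup "orb_kernel y x" "add_monoid (orb_homs y x)" by (rule orb_kernel_subgroup)
  interpret S: module_surjection R "orb_homs y x" "Hom B y x" "orb_sum y x" by (rule orb_surjection)
  show "{v \<in> carrier (orb_homs y x). orb_sum y x v = \<zero>\<^bsub>Hom B y x\<^esub>} \<subseteq> orb_kernel y x"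
  proof clarify
    fix v assume v: "v \<in> carrier (orb_homs y x)" "orb_sum y x v = \<zero>\<^bsub>Hom B y x\<^esub>"
    obtain w where w: "w \<in> carrier (orb_homs y x)" "w \<ominus>\<^bsub>orb_homs y x\<^esub> v \<in> orb_kernel y x"
      and normal: "\<forall>t\<in>carrier G. \<forall>s\<in>carrier G. t \<noteq> \<one>\<^bsub>G\<^esub> \<longrightarrow> w ((y, t), (x, s)) = \<zero>\<^bsub>Hom B y x\<^esub>"
      using orb_normal_form[OF v(1)] by blast
    have "orb_sum y x (w \<ominus>\<^bsub>orb_homs y x\<^esub> v) = \<zero>\<^bsub>Hom B y x\<^esub>"
      using orb_kernel_subset w(2) by blast
    moreover have "\<ominus>\<^bsub>Hom B y x\<^esub> \<zero>\<^bsub>Hom B y x\<^esub> = \<zero>\<^bsub>Hom B y x\<^esub>"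
      by (rule F.N.minus_equality) simp_all
    ultimately have "orb_sum y x w = \<zero>\<^bsub>Hom B y x\<^esub>" using v w(1) by (simp add: X.minus_eq)
    then have "w = \<zero>\<^bsub>orb_homs y x\<^esub>" using orb_sum_inj_normal[OF w(1)] normal by blast
    then have "\<ominus>\<^bsub>orb_homs y x\<^esub> v \<in> orb_kernel y x" using w(2) v by (simp add: X.minus_eq)
    from K.m_inv_closed[OF this] show "v \<in> orb_kernel y x"
      using v by (simp add: a_inv_def[symmetric])
  qed
qed (rule orb_kernel_subset)

text \<open>As the augmentation submodule is the fibre over zero, its cosets are the fibres of the
  sum map, so the sum of any representative identifies a class.\<close>

lemma coset_orb_kernel:
  assumes "v \<in> carrier (orb_homs y x)"
  shows "orb_kernel y x +>\<^bsub>orb_homs y x\<^esub> v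
    = module_surjection.fibre (orb_homs y x) (orb_sum y x) (orb_sum y x v)"
  using module_surjection.coset_eq_fibre[OF orb_surjection assms]
  by (simp add: orb_kernel_eq module_surjection.fibre_def[OF orb_surjection])

end

abbreviation orb_fibre where "orb_fibre y x \<equiv> module_surjection.fibre (orb_homs y x) (orb_sum y x)"


subsection \<open>Composition in the quotient category\<close>

abbreviation orb_comp where
  "orb_comp z y x \<equiv> orbit_homs_comp G smash trans translation_mor (orb z) (orb y) (orb x)"

text \<open>Each pair of entries contributes one entry, whose underlying morphism is their composite
  in \<open>B\<close>, since the translation that makes them composable changes only the position.
  Summing over all pairs and using bilinearity gives the composite of the sums.\<close>

lemma orb_comp:
  assumes xyz: "x \<in> Obj B" "y \<in> Obj B" "z \<in> Obj B"
    and g: "g \<in> carrier (orb_homs z y)" and f: "f \<in> carrier (orb_homs y x)"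
  shows "orb_comp z y x g f \<in> carrier (orb_homs z x)"
    "orb_sum z x (orb_comp z y x g f) = Comp B z y x (orb_sum z y g) (orb_sum y x f)"
proof -
  interpret g: submodule_family R "Hom B z y" "orb z \<times> orb y" "orb_deg z y" "\<lambda>(q, p). Hom smash q p"
    by (rule orb_family[OF xyz(2,3)])
  interpret f: submodule_family R "Hom B y x" "orb y \<times> orb x" "orb_deg y x" "\<lambda>(q, p). Hom smash q p"
    by (rule orb_family[OF xyz(1,2)])
  interpret X: module R "orb_homs z x" by (rule module_orb_homs[OF xyz(1,3)])
  interpret N: module R "Hom B z x" by (rule hom_module[OF xyz(1,3)])
  let ?A = "{i \<in> orb z \<times> orb y. g i \<noteq> \<zero>\<^bsub>Hom B z y\<^esub>}"
  let ?C = "{i \<in> orb y \<times> orb x. f i \<noteq> \<zero>\<^bsub>Hom B y x\<^esub>}"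
  have g': "g \<in> carrier g.X" and f': "f \<in> carrier f.X"
    using g f orb_homs_eq[OF xyz(2,3)] orb_homs_eq[OF xyz(1,2)] by auto
  define F where "F = (\<lambda>((z', y'), (y'', x')).
    let s = (THE s. s \<in> carrier G \<and> trans s y'' = y')
    in orbit_homs_incl smash (orb z) (orb x) z' (trans s x')
      (Comp smash z' y' (trans s x') (g (z', y')) (translation_mor s y'' x' (f (y'', x')))))"
  have gN: "g i \<in> carrier (Hom B z y)" if "i \<in> orb z \<times> orb y" for i by (rule g.X_in_N[OF g' that])
  have fN: "f i \<in> carrier (Hom B y x)" if "i \<in> orb y \<times> orb x" for i by (rule f.X_in_N[OF f' that])
  have F: "F (i, j) \<in> carrier (orb_homs z x) \<and> orb_sum z x (F (i, j)) = Comp B z y x (g i) (f j)"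
    if i: "i \<in> orb z \<times> orb y" and j: "j \<in> orb y \<times> orb x" for i j
  proof -
    obtain u t' where i_eq: "i = ((z, u), (y, t'))" and ut: "u \<in> carrier G" "t' \<in> carrier G"
      using i by auto
    obtain t r where j_eq: "j = ((y, t), (x, r))" and tr: "t \<in> carrier G" "r \<in> carrier G"
      using j by auto
    \<comment> \<open>The unique element carrying \<open>(y, t)\<close> to
      \<open>(y, t')\<close>.\<close>
    let ?s = "t' \<otimes>\<^bsub>G\<^esub> inv\<^bsub>G\<^esub> t"
    have "(THE s. s \<in> carrier G \<and> trans s (y, t) = (y, t')) = ?s"
    proof (rule the_equality)
      show "?s \<in> carrier G \<and> trans ?s (y, t) = (y, t')" using xyz ut tr by (simp add: G.m_assoc)
      fix s assume "s \<in> carrier G \<and> trans s (y, t) = (y, t')"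
      then show "s = ?s" using xyz ut tr by (auto simp: G.m_assoc)
    qed
    then have F_eq: "F (i, j) = orbit_homs_incl smash (orb z) (orb x) (z, u) (x, ?s \<otimes>\<^bsub>G\<^esub> r)
        (Comp B z y x (g i) (f j))"
      using xyz tr by (simp add: F_def i_eq j_eq Let_def translation_mor_def)
    \<comment> \<open>The entry of \<open>f\<close> keeps its degree after translation by
      \<open>?s\<close>, so \<open>degree_comp'\<close> applies with middle object
      \<open>(y, t')\<close>.\<close>
    have "inv\<^bsub>G\<^esub> t' \<otimes>\<^bsub>G\<^esub> (?s \<otimes>\<^bsub>G\<^esub> r) = inv\<^bsub>G\<^esub> t \<otimes>\<^bsub>G\<^esub> r"
      using ut tr by (simp add: G.m_assoc[symmetric])
    then have "f j \<in> D y x (inv\<^bsub>G\<^esub> t' \<otimes>\<^bsub>G\<^esub> (?s \<otimes>\<^bsub>G\<^esub> r))"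
      using f.X_component[OF f' j] by (simp add: j_eq)
    moreover have "g i \<in> D z y (inv\<^bsub>G\<^esub> u \<otimes>\<^bsub>G\<^esub> t')"
      using g.X_component[OF g' i] by (simp add: i_eq)
    ultimately have "Comp B z y x (g i) (f j) \<in> D z x (inv\<^bsub>G\<^esub> u \<otimes>\<^bsub>G\<^esub> (?s \<otimes>\<^bsub>G\<^esub> r))"
      using xyz ut tr by (intro degree_comp'[of x y z _ t' u]) simp_all
    then show ?thesis
      unfolding F_eq using orb_incl[OF xyz(1,3)] ut tr by (simp add: G.m_closed)
  qed
  \<comment> \<open>Morphism modules of the smash product have the zeros of \<open>B\<close>, so the
    index set of the composite is the product of the two supports.\<close>
  have "{((z', y'), (y'', x')). z' \<in> orb z \<and> y' \<in> orb y \<and> y'' \<in> orb y \<and> x' \<in> orb x \<and>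
      g (z', y') \<noteq> \<zero>\<^bsub>Hom smash z' y'\<^esub> \<and> f (y'', x') \<noteq> \<zero>\<^bsub>Hom smash y'' x'\<^esub>} = ?A \<times> ?C"
    by auto
  then have comp_eq: "orb_comp z y x g f = (\<Oplus>\<^bsub>orb_homs z x\<^esub>k\<in>?A \<times> ?C. F k)"
    unfolding orbit_homs_comp_def F_def by simp
  have F_Pi: "F \<in> ?A \<times> ?C \<rightarrow> carrier (orb_homs z x)" using F by auto
  show "orb_comp z y x g f \<in> carrier (orb_homs z x)"
    unfolding comp_eq by (rule X.finsum_closed[OF F_Pi])
  let ?c = "\<lambda>i j. Comp B z y x (g i) (f j)"
  have c_closed: "?c i j \<in> carrier (Hom B z x)" if "i \<in> orb z \<times> orb y" "j \<in> orb y \<times> orb x" for i j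
    by (rule Comp_closed[OF xyz fN[OF that(2)] gN[OF that(1)]])
  have "orb_sum z x (orb_comp z y x g f) = (\<Oplus>\<^bsub>Hom B z x\<^esub>k\<in>?A \<times> ?C. orb_sum z x (F k))"
    unfolding comp_eq
    by (rule module_hom_finsum[OF X.module_axioms N.module_axioms orb_sum_hom[OF xyz(1,3)] F_Pi])
  also have "\<dots> = (\<Oplus>\<^bsub>Hom B z x\<^esub>k\<in>?A \<times> ?C. ?c (fst k) (snd k))"
  proof (rule N.add.finprod_cong'[OF refl])
    show "(\<lambda>k. ?c (fst k) (snd k)) \<in> ?A \<times> ?C \<rightarrow> carrier (Hom B z x)"
      by (intro Pi_I c_closed) auto
    show "orb_sum z x (F k) = ?c (fst k) (snd k)" if "k \<in> ?A \<times> ?C" for k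
      using F[of "fst k" "snd k"] that by (simp add: mem_Times_iff)
  qed
  \<comment> \<open>Linearity in the right argument then collapses the inner sum, linearity in the
    left argument the outer one.\<close>
  also have "\<dots> = (\<Oplus>\<^bsub>Hom B z x\<^esub>i\<in>?A. \<Oplus>\<^bsub>Hom B z x\<^esub>j\<in>?C. ?c i j)"
  proof -
    have "(\<lambda>k. ?c (fst k) (snd k)) \<in> ?A \<times> ?C \<rightarrow> carrier (Hom B z x)"
      by (intro Pi_I c_closed) auto
    from N.add.finprod_Times[OF g.X_finite[OF g'] f.X_finite[OF f'] this] show ?thesis by simp
  qed
  also have "\<dots> = (\<Oplus>\<^bsub>Hom B z x\<^esub>i\<in>?A. Comp B z y x (g i) (orb_sum y x f))"
  proof (rule N.add.finprod_cong'[OF refl])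
    have "orb_sum y x f \<in> carrier (Hom B y x)"
      by (rule module_homD(1)[OF orb_sum_hom[OF xyz(1,2)] f])
    then show "(\<lambda>i. Comp B z y x (g i) (orb_sum y x f)) \<in> ?A \<rightarrow> carrier (Hom B z x)"
      by (intro Pi_I Comp_closed xyz gN) simp_all
    show "(\<Oplus>\<^bsub>Hom B z x\<^esub>j\<in>?C. ?c i j) = Comp B z y x (g i) (orb_sum y x f)" if "i \<in> ?A" for i
      unfolding family_sum_def
      by (rule module_hom_finsum[symmetric, OF f.N.module_axioms N.module_axioms
            comp_linear_right[OF xyz gN]]) (use that fN in auto)
  qed
  also have "\<dots> = Comp B z y x (orb_sum z y g) (orb_sum y x f)"
    unfolding family_sum_def[of "Hom B z y"]
    by (rule module_hom_finsum[symmetric, OF g.N.module_axioms N.module_axioms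
          comp_linear_left[OF xyz module_homD(1)[OF orb_sum_hom[OF xyz(1,2)] f]]]) (use gN in auto)
  finally show "orb_sum z x (orb_comp z y x g f) = Comp B z y x (orb_sum z y g) (orb_sum y x f)" .
qed

section \<open>The quotient category and its isomorphism with \<open>B\<close>\<close>

abbreviation smash_quotient where
  "smash_quotient \<equiv> quotient_category R G smash trans translation_mor"

text \<open>The group has an element, so the orbit \<open>orb x\<close> determines \<open>x\<close>;
  surjectivity is \<open>trans_orbit\<close>.\<close>

lemma smash_quotient_Obj: "bij_betw orb (Obj B) (Obj smash_quotient)"
proof -
  have "inj_on orb (Obj B)"
  proof (rule inj_onI)
    fix x y assume "orb x = orb y"
    moreover have "(x, \<one>\<^bsub>G\<^esub>) \<in> orb x" by simp
    ultimately show "x = y" by blast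
  qed
  moreover have "orb ` Obj B = orbits G (Obj smash) trans"
  proof
    show "orb ` Obj B \<subseteq> orbits G (Obj smash) trans"
    proof
      fix \<alpha> assume "\<alpha> \<in> orb ` Obj B"
      then obtain x where "x \<in> Obj B" "\<alpha> = orbit G trans (x, \<one>\<^bsub>G\<^esub>)"
        using trans_orbit[OF _ G.one_closed] by blast
      then show "\<alpha> \<in> orbits G (Obj smash) trans" unfolding orbits_def by auto
    qed
    show "orbits G (Obj smash) trans \<subseteq> orb ` Obj B"
      unfolding orbits_def using trans_orbit by auto
  qed
  ultimately show ?thesis by (simp add: bij_betw_def quotient_category_def)
qed

lemma smash_quotient_Hom:
  "Hom smash_quotient (orb y) (orb x) = quotient_module (orb_homs y x) (orb_kernel y x)"
  by (simp add: quotient_category_def)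

lemma orb_kernel_fibre:
  assumes "x \<in> Obj B" "y \<in> Obj B"
  shows "orb_kernel y x = orb_fibre y x \<zero>\<^bsub>Hom B y x\<^esub>"
  using orb_kernel_eq[OF assms] by (simp add: module_surjection.fibre_def[OF orb_surjection[OF assms]])

text \<open>By \<open>orb_comp\<close> every choice of representatives yields a family with the same
  sum, hence the same coset. The union over representatives is therefore this single fibre, the
  fibres of \<open>f\<close> and \<open>g\<close> being nonempty.\<close>

lemma orb_fibre_Comp:
  assumes xyz: "x \<in> Obj B" "y \<in> Obj B" "z \<in> Obj B"
    and f: "f \<in> carrier (Hom B y x)" and g: "g \<in> carrier (Hom B z y)"
  shows "Comp smash_quotient (orb z) (orb y) (orb x) (orb_fibre z y g) (orb_fibre y x f)
    = orb_fibre z x (Comp B z y x g f)"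
proof -
  note fibre = module_surjection.fibre_def[OF orb_surjection]
  have "orb_kernel z x +>\<^bsub>orb_homs z x\<^esub> orb_comp z y x g' f' = orb_fibre z x (Comp B z y x g f)"
    if "g' \<in> orb_fibre z y g" "f' \<in> orb_fibre y x f" for g' f'
    using that coset_orb_kernel[OF xyz(1,3)] orb_comp[OF xyz]
    by (simp add: fibre[OF xyz(1,2)] fibre[OF xyz(2,3)])
  moreover obtain g' where "g' \<in> orb_fibre z y g"
    using module_surjection.fibre_nonempty[OF orb_surjection g] xyz by (auto simp: fibre[OF xyz(2,3)])
  moreover obtain f' where "f' \<in> orb_fibre y x f"
    using module_surjection.fibre_nonempty[OF orb_surjection f] xyz by (auto simp: fibre[OF xyz(1,2)])
  ultimately show ?thesis by (auto simp: quotient_category_def)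
qed

text \<open>The included family has the single entry \<open>f\<close>, hence sum \<open>f\<close>;
  its class does not depend on the chosen \<open>t\<close> and \<open>s\<close>.\<close>

lemma quotient_class_eq_fibre:
  assumes xy: "x \<in> Obj B" "y \<in> Obj B" and "t \<in> carrier G" "s \<in> carrier G"
    and "f \<in> D y x (inv\<^bsub>G\<^esub> t \<otimes>\<^bsub>G\<^esub> s)"
  shows "quotient_class R G smash trans translation_mor (orb y) (orb x) (y, t) (x, s) f = orb_fibre y x f"
  using coset_orb_kernel[OF xy] orb_incl[OF assms] by (simp add: quotient_class_def)

text \<open>At each object of the orbit the identity is \<open>Idn B x\<close>, of degree 1, so all
  members of the union are the same fibre.\<close>

lemma orb_fibre_Idn:
  assumes x: "x \<in> Obj B"
  shows "Idn smash_quotient (orb x) = orb_fibre x x (Idn B x)"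
proof -
  have "quotient_class R G smash trans translation_mor (orb x) (orb x) p p (Idn smash p)
      = orb_fibre x x (Idn B x)" if "p \<in> orb x" for p
    using that quotient_class_eq_fibre[OF x x] degree_id[OF x] by auto
  moreover have "(x, \<one>\<^bsub>G\<^esub>) \<in> orb x" by simp
  ultimately show ?thesis unfolding quotient_category_def by (simp only: k_cat.simps) blast
qed

text \<open>Transport along \<open>orb\<close> and \<open>orb_fibre\<close> yields the category laws
  of the quotient together with the isomorphism.\<close>

lemma smash_quotient_iso:
  "\<exists>Fo Fm. k_category_iso R smash_quotient B Fo Fm \<and> (\<forall>x\<in>Obj B. Fo (orb x) = x) \<and>
    (\<forall>x\<in>Obj B. \<forall>y\<in>Obj B. \<forall>f\<in>carrier (Hom B y x). Fm (orb y) (orb x) (orb_fibre y x f) = f)"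
proof (rule k_category_iso_transport)
  show "k_category R B" ..
  show "bij_betw orb (Obj B) (Obj smash_quotient)" by (rule smash_quotient_Obj)
  fix x assume x: "x \<in> Obj B"
  then show "orb_fibre x x (Idn B x) = Idn smash_quotient (orb x)" by (simp only: orb_fibre_Idn)
  fix y assume y: "y \<in> Obj B"
  note S = module_surjection.bij_betw_fibre[OF orb_surjection[OF x y]]
    module_surjection.fibre_hom[OF orb_surjection[OF x y]]
  show "bij_betw (orb_fibre y x) (carrier (Hom B y x)) (carrier (Hom smash_quotient (orb y) (orb x)))"
    "orb_fibre y x \<in> module_hom R (Hom B y x) (Hom smash_quotient (orb y) (orb x))"
    unfolding smash_quotient_Hom orb_kernel_fibre[OF x y] by (rule S)+
  show "orb_fibre y x \<zero>\<^bsub>Hom B y x\<^esub> = \<zero>\<^bsub>Hom smash_quotient (orb y) (orb x)\<^esub>"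
    unfolding smash_quotient_Hom orb_kernel_fibre[OF x y] by (simp add: quotient_module_def)
  fix z f g assume "z \<in> Obj B" "f \<in> carrier (Hom B y x)" "g \<in> carrier (Hom B z y)"
  then show "orb_fibre z x (Comp B z y x g f)
      = Comp smash_quotient (orb z) (orb y) (orb x) (orb_fibre z y g) (orb_fibre y x f)"
    using orb_fibre_Comp[OF x y] by simp
qed

end

text \<open>The last two clauses make the isomorphism canonical: every object of the quotient is an
  orbit, and the classes of homogeneous morphisms generate its morphism modules, so
  \<open>Fo\<close> and \<open>Fm\<close> are determined there.\<close>

theorem proposition3p2:
  fixes R :: "('k, 'r) ring_scheme" and G :: "('g, 'h) monoid_scheme"
    and B :: "('o, 'k, 'm) k_cat" and D :: "'o \<Rightarrow> 'o \<Rightarrow> 'g \<Rightarrow> 'm set"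
  assumes "cring R" and "group G" and "graded_category R G B D"
  shows "free_G_category R G (smash_product G B D) (translation_obj G B) translation_mor \<and>
    (\<exists>Fo Fm.
      k_category_iso R
        (quotient_category R G (smash_product G B D) (translation_obj G B) translation_mor)
        B Fo Fm \<and>
      (\<forall>x\<in>Obj B. \<forall>s\<in>carrier G. Fo (orbit G (translation_obj G B) (x, s)) = x) \<and>
      (\<forall>x\<in>Obj B. \<forall>y\<in>Obj B. \<forall>s\<in>carrier G. \<forall>t\<in>carrier G. \<forall>f\<in>D y x (inv\<^bsub>G\<^esub> t \<otimes>\<^bsub>G\<^esub> s).
        let \<alpha> = orbit G (translation_obj G B) (x, s);
            \<beta> = orbit G (translation_obj G B) (y, t)
        in Fm \<beta> \<alpha>
             (quotient_class R G (smash_product G B D) (translation_obj G B) translation_mor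
               \<beta> \<alpha> (y, t) (x, s) f) = f))"
proof -
  interpret graded_category R G B D by fact
  obtain Fo Fm where iso: "k_category_iso R smash_quotient B Fo Fm"
    and Fo: "\<And>x. x \<in> Obj B \<Longrightarrow> Fo (orb x) = x"
    and Fm: "\<And>x y f. \<lbrakk>x \<in> Obj B; y \<in> Obj B; f \<in> carrier (Hom B y x)\<rbrakk>
      \<Longrightarrow> Fm (orb y) (orb x) (orb_fibre y x f) = f"
    using smash_quotient_iso by blast
  have Fm_class: "Fm (orb y) (orb x)
      (quotient_class R G smash trans translation_mor (orb y) (orb x) (y, t) (x, s) f) = f"
    if "x \<in> Obj B" "y \<in> Obj B" "s \<in> carrier G" "t \<in> carrier G" "f \<in> D y x (inv\<^bsub>G\<^esub> t \<otimes>\<^bsub>G\<^esub> s)"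
    for x y s t f
    using that quotient_class_eq_fibre[of x y t s f] Fm[of x y f]
      degree_closed[of x y "inv\<^bsub>G\<^esub> t \<otimes>\<^bsub>G\<^esub> s" f] by simp
  show ?thesis
    by (intro conjI exI[of _ Fo] exI[of _ Fm] smash_free_G_category iso ballI)
      (simp_all add: Let_def trans_orbit Fo Fm_class)
qed

end
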